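(* Let $X$ be a (real, non-trivial) Banach space such that its dual $X^*$ has the weak operator Daugavet property (WODP), and let $Y$ be any (real, non-trivial) Banach space. Then the injective tensor product $X\widehat{\otimes}_\varepsilon Y$ has the diametral diameter two property (DD2P).
   Context: All Banach spaces are real and non-trivial (i.e. $\neq\{0\}$). $B_Z$ and $S_Z$ denote the closed unit ball and the unit sphere of a Banach space $Z$, and $Z^*$ its topological dual. Slice of $B_Z$: a set of the form $\{z\in B_Z: z^*(z)>\sup z^*(B_Z)-\alpha\}$ with $z^*\in Z^*$ and $\alpha>0$. WODP: a Banach space $Z$ has the weak operator Daugavet property (WODP) if for all $n\in\mathbb N$, $z_1,\ldots,z_n\in S_Z$, every $\varepsilon>0$, every slice $S$ of $B_Z$ and every $z'\in B_Z$ there exist $z\in S$ and a bounded linear operator $T:Z\to Z$ with $\|T\|\leq 1+\varepsilon$, $\|T(z_i)-z_i\|<\varepsilon$ for every $i\in\{1,\ldots,n\}$, and $\|T(z)-z'\|<\varepsilon$. DD2P: a Banach space $Z$ has the diametral diameter two property (DD2P) if for every non-empty relatively weakly open subset $W$ of $B_Z$, every $z\in W\cap S_Z$ and every $\varepsilon>0$ there exists $w\in W$ with $\|w-z\|>2-\varepsilon$. Injective tensor product: $X\widehat{\otimes}_\varepsilon Y$ is the completion of the algebraic tensor product $X\otimes Y$ under the norm $\|u\|_\varepsilon=\sup\{|\sum_{i=1}^n x^*(x_i)y^*(y_i)|: x^*\in S_{X^*},\ y^*\in S_{Y^*}\}$ for $u=\sum_{i=1}^n x_i\otimes y_i$. 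*)

theory Defs
  imports "HOL-Analysis.Analysis" "HOL-Library.Poly_Mapping"
begin

section \<open>The Hahn--Banach theorem\<close>

text \<open>
  Needed below to see that the injective norm is definite. Functionals on subspaces are
  represented by their graphs, i.e. by linear subspaces of \<open>'a \<times> real\<close>.
\<close>

lemma hahn_banach_step:
  fixes G :: "('a::real_normed_vector \<times> real) set"
  assumes G: "subspace G" and le: "\<And>p. p \<in> G \<Longrightarrow> snd p \<le> norm (fst p)"
  shows "\<exists>G'. subspace G' \<and> G \<subseteq> G' \<and> x0 \<in> fst ` G' \<and> (\<forall>p\<in>G'. snd p \<le> norm (fst p))"
proof -
  define c where "c = (SUP p\<in>G. snd p - norm (fst p - x0))"
  have zero: "0 \<in> G" using G by (rule subspace_0)
  have key: "snd p - norm (fst p - x0) \<le> norm (fst q + x0) - snd q" if "p \<in> G" "q \<in> G" for p q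
  proof -
    have "snd (p + q) \<le> norm (fst (p + q))" using that G by (intro le subspace_add)
    also have "\<dots> = norm ((fst p - x0) + (fst q + x0))" by simp
    also have "\<dots> \<le> norm (fst p - x0) + norm (fst q + x0)" by (rule norm_triangle_ineq)
    finally show ?thesis by simp
  qed
  have lo: "snd p - norm (fst p - x0) \<le> c" if "p \<in> G" for p
    unfolding c_def
  proof (rule cSUP_upper[OF that])
    show "bdd_above ((\<lambda>p. snd p - norm (fst p - x0)) ` G)"
      using key[OF _ zero] by (intro bdd_aboveI2)
  qed
  have hi: "c \<le> norm (fst q + x0) - snd q" if "q \<in> G" for q
    unfolding c_def using zero key[OF _ that] by (intro cSUP_least) auto
  define G' where "G' = {p + q |p q. p \<in> G \<and> q \<in> span {(x0, c)}}"
  have "subspace G'"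
    unfolding G'_def by (intro subspace_sums G subspace_span)
  moreover have "G \<subseteq> G'"
  proof
    fix p assume "p \<in> G"
    then show "p \<in> G'" unfolding G'_def
      by (intro CollectI exI[of _ p] exI[of _ 0]) (auto intro: span_zero)
  qed
  moreover have "x0 \<in> fst ` G'"
  proof -
    have "0 + (x0, c) \<in> G'"
      unfolding G'_def using zero span_base[of "(x0, c)" "{(x0, c)}"] by blast
    then show ?thesis by force
  qed
  moreover have "snd p \<le> norm (fst p)" if p: "p \<in> G'" for p
  proof -
    obtain q t where q: "q \<in> G" and p: "p = q + t *\<^sub>R (x0, c)"
      using p unfolding G'_def span_singleton by blast
    consider "t = 0" | "t > 0" | "t < 0" by linarith
    then show ?thesis
    proof cases
      case 1
      then show ?thesis using le[OF q] p by simp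
    next
      case 2
      have "(1 / t) *\<^sub>R q \<in> G" using G q by (rule subspace_scale)
      from hi[OF this] have "t * c \<le> t * (norm (fst q /\<^sub>R t + x0) - snd q / t)"
        using 2 by (simp add: divide_inverse mult.commute)
      also have "\<dots> = norm (t *\<^sub>R (fst q /\<^sub>R t + x0)) - snd q"
        unfolding norm_scaleR using 2 by (simp add: right_diff_distrib)
      also have "t *\<^sub>R (fst q /\<^sub>R t + x0) = fst q + t *\<^sub>R x0"
        using 2 by (simp add: algebra_simps)
      finally show ?thesis using p by simp
    next
      case 3
      define s where "s = - t"
      have s: "s > 0" using 3 by (simp add: s_def)
      have "(1 / s) *\<^sub>R q \<in> G" using G q by (rule subspace_scale)
      from lo[OF this] have "s * (snd q / s - norm (fst q /\<^sub>R s - x0)) \<le> s * c"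
        using s by (simp add: divide_inverse mult.commute)
      moreover have "s * (snd q / s - norm (fst q /\<^sub>R s - x0))
          = snd q - norm (s *\<^sub>R (fst q /\<^sub>R s - x0))"
        unfolding norm_scaleR using s by (simp add: right_diff_distrib)
      moreover have "s *\<^sub>R (fst q /\<^sub>R s - x0) = fst q + t *\<^sub>R x0"
        using s by (simp add: algebra_simps s_def)
      ultimately have "snd q - norm (fst q + t *\<^sub>R x0) \<le> s * c" by metis
      then show ?thesis using p by (simp add: s_def)
    qed
  qed
  ultimately show ?thesis by blast
qed

lemma hahn_banach_graph:
  fixes G :: "('a::real_normed_vector \<times> real) set"
  assumes G: "subspace G" and le: "\<And>p. p \<in> G \<Longrightarrow> snd p \<le> norm (fst p)"
  shows "\<exists>f :: 'a \<Rightarrow>\<^sub>L real. norm f \<le> 1 \<and> (\<forall>(x, r)\<in>G. blinfun_apply f x = r)"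
proof -
  define A where "A = {H. subspace H \<and> G \<subseteq> H \<and> (\<forall>p\<in>H. snd p \<le> norm (fst p))}"
  have "\<exists>M\<in>A. \<forall>X\<in>A. M \<subseteq> X \<longrightarrow> X = M"
  proof (rule subset_Zorn)
    fix C assume C: "subset.chain A C"
    show "\<exists>U\<in>A. \<forall>X\<in>C. X \<subseteq> U"
    proof (cases "C = {}")
      case True
      have "G \<in> A" using G le by (auto simp: A_def)
      with True show ?thesis by blast
    next
      case False
      have CA: "C \<subseteq> A" and lin: "\<And>X Y. X \<in> C \<Longrightarrow> Y \<in> C \<Longrightarrow> X \<subseteq> Y \<or> Y \<subseteq> X"
        using C by (auto simp: subset_chain_def)
      have "subspace (\<Union>C)"
        unfolding subspace_def
      proof (intro conjI ballI allI)
        show "0 \<in> \<Union>C" using False CA by (auto simp: A_def subspace_def)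
      next
        fix x y assume "x \<in> \<Union>C" "y \<in> \<Union>C"
        then obtain X Y where "X \<in> C" "Y \<in> C" "x \<in> X" "y \<in> Y" by blast
        with lin[of X Y] obtain Z where "Z \<in> C" "x \<in> Z" "y \<in> Z" by blast
        with CA have "x + y \<in> Z" by (intro subspace_add) (auto simp: A_def)
        with \<open>Z \<in> C\<close> show "x + y \<in> \<Union>C" by blast
      next
        fix c :: real and x assume "x \<in> \<Union>C"
        then obtain X where X: "X \<in> C" "x \<in> X" by blast
        with CA have "c *\<^sub>R x \<in> X" by (intro subspace_scale) (auto simp: A_def)
        with X show "c *\<^sub>R x \<in> \<Union>C" by blast
      qed
      moreover have "G \<subseteq> \<Union>C" using False CA by (auto simp: A_def)
      moreover have "\<forall>p\<in>\<Union>C. snd p \<le> norm (fst p)" using CA by (auto simp: A_def)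
      ultimately have "\<Union>C \<in> A" by (simp add: A_def)
      then show ?thesis by blast
    qed
  qed
  then obtain M where M: "M \<in> A" and max: "\<And>X. X \<in> A \<Longrightarrow> M \<subseteq> X \<Longrightarrow> X = M" by blast
  have subM: "subspace M" and GM: "G \<subseteq> M" and leM: "\<And>p. p \<in> M \<Longrightarrow> snd p \<le> norm (fst p)"
    using M by (auto simp: A_def)
  have tot: "\<exists>r. (x, r) \<in> M" for x
  proof -
    obtain G' where G': "subspace G'" "M \<subseteq> G'" "x \<in> fst ` G'" "\<forall>p\<in>G'. snd p \<le> norm (fst p)"
      using hahn_banach_step[OF subM leM] by blast
    then have "G' \<in> A" using GM by (auto simp: A_def)
    with max G' have "G' = M" by blast
    with G' show ?thesis by force
  qed
  have uniq: "r = s" if "(x, r) \<in> M" "(x, s) \<in> M" for x r s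
    using leM[OF subspace_diff[OF subM that(1) that(2)]]
          leM[OF subspace_diff[OF subM that(2) that(1)]] by simp
  define f where "f x = (THE r. (x, r) \<in> M)" for x
  have fI: "f x = r" if "(x, r) \<in> M" for x r
    unfolding f_def using that uniq by blast
  have fM: "(x, f x) \<in> M" for x
    using tot[of x] fI by metis
  have bnd: "norm (f x) \<le> norm x * 1" for x
    using leM[OF fM[of x]] leM[OF subspace_neg[OF subM fM[of x]]] by auto
  have bl: "bounded_linear f"
  proof (rule bounded_linear_intro)
    show "f (x + y) = f x + f y" for x y
      using subspace_add[OF subM fM[of x] fM[of y]] by (intro fI) simp
    show "f (r *\<^sub>R x) = r *\<^sub>R f x" for r x
      using subspace_scale[OF subM fM[of x], of r] by (intro fI) simp
    show "norm (f x) \<le> norm x * 1" for x by (rule bnd)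
  qed
  define F where "F = Blinfun f"
  have F: "blinfun_apply F = f" unfolding F_def using bl by (rule bounded_linear_Blinfun_apply)
  have "norm F \<le> 1" using bnd by (intro norm_blinfun_bound) (auto simp: F)
  moreover have "\<forall>(x, r)\<in>G. blinfun_apply F x = r" using GM fI by (auto simp: F)
  ultimately show ?thesis by blast
qed

lemma exists_norming_functional:
  fixes x :: "'a::real_normed_vector"
  assumes "x \<noteq> 0"
  shows "\<exists>f :: 'a \<Rightarrow>\<^sub>L real. norm f = 1 \<and> blinfun_apply f x = norm x"
proof -
  have "\<exists>f :: 'a \<Rightarrow>\<^sub>L real. norm f \<le> 1 \<and> (\<forall>(y, r)\<in>span {(x, norm x)}. blinfun_apply f y = r)"
  proof (rule hahn_banach_graph)
    fix p assume "p \<in> span {(x, norm x)}"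
    then obtain t where "p = t *\<^sub>R (x, norm x)" unfolding span_singleton by blast
    then show "snd p \<le> norm (fst p)" by (simp add: mult_right_mono)
  qed (rule subspace_span)
  then obtain f :: "'a \<Rightarrow>\<^sub>L real"
    where f: "norm f \<le> 1" "\<forall>(y, r)\<in>span {(x, norm x)}. blinfun_apply f y = r" by blast
  have "(x, norm x) \<in> span {(x, norm x)}" by (rule span_base) simp
  from bspec[OF f(2) this] have fx: "f x = norm x" by simp
  have "norm x \<le> norm f * norm x" using norm_blinfun[of f x] fx by simp
  with assms have "1 \<le> norm f" by simp
  with f(1) fx show ?thesis by (intro exI[of _ f]) simp
qed

lemma functionals_separate_points:
  fixes x :: "'a::real_normed_vector"
  assumes "\<And>f :: 'a \<Rightarrow>\<^sub>L real. blinfun_apply f x = 0"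
  shows "x = 0"
  using exists_norming_functional[of x] assms by force


section \<open>Completion of a normed space\<close>

definition cauchy_rel :: "(nat \<Rightarrow> 'a::real_normed_vector) \<Rightarrow> (nat \<Rightarrow> 'a) \<Rightarrow> bool" where
  "cauchy_rel s t \<longleftrightarrow> Cauchy s \<and> Cauchy t \<and> (\<lambda>n. s n - t n) \<longlonglongrightarrow> 0"

lemma part_equivp_cauchy_rel: "part_equivp (cauchy_rel :: (nat \<Rightarrow> 'a::real_normed_vector) \<Rightarrow> _)"
proof (rule part_equivpI)
  show "\<exists>s :: nat \<Rightarrow> 'a. cauchy_rel s s"
    by (intro exI[of _ "\<lambda>_. 0"]) (simp add: cauchy_rel_def Cauchy_def)
  show "symp (cauchy_rel :: (nat \<Rightarrow> 'a) \<Rightarrow> _)"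
  proof (rule sympI)
    fix s t :: "nat \<Rightarrow> 'a" assume "cauchy_rel s t"
    then show "cauchy_rel t s"
      unfolding cauchy_rel_def using tendsto_minus[of "\<lambda>n. s n - t n" 0 sequentially] by simp
  qed
  show "transp (cauchy_rel :: (nat \<Rightarrow> 'a) \<Rightarrow> _)"
  proof (rule transpI)
    fix s t u :: "nat \<Rightarrow> 'a" assume "cauchy_rel s t" "cauchy_rel t u"
    then show "cauchy_rel s u"
      unfolding cauchy_rel_def
      using tendsto_add[of "\<lambda>n. s n - t n" 0 sequentially "\<lambda>n. t n - u n" 0] by simp
  qed
qed

quotient_type (overloaded) 'a completion = "nat \<Rightarrow> 'a::real_normed_vector" / partial: cauchy_rel
  by (rule part_equivp_cauchy_rel)

lemma Cauchy_add:
  fixes s t :: "nat \<Rightarrow> 'a::real_normed_vector"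
  assumes "Cauchy s" "Cauchy t"
  shows "Cauchy (\<lambda>n. s n + t n)"
  unfolding Cauchy_iff
proof (intro allI impI)
  fix e :: real assume "e > 0"
  then obtain M N where "\<And>m n. m \<ge> M \<Longrightarrow> n \<ge> M \<Longrightarrow> norm (s m - s n) < e / 2"
    and "\<And>m n. m \<ge> N \<Longrightarrow> n \<ge> N \<Longrightarrow> norm (t m - t n) < e / 2"
    using assms unfolding Cauchy_iff by (meson half_gt_zero)
  then show "\<exists>M. \<forall>m\<ge>M. \<forall>n\<ge>M. norm (s m + t m - (s n + t n)) < e"
    by (intro exI[of _ "max M N"]) (auto simp: add_diff_add intro!: norm_add_less[of _ "e/2" _ "e/2", simplified])
qed

lemma Cauchy_scaleR:
  fixes s :: "nat \<Rightarrow> 'a::real_normed_vector"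
  assumes "Cauchy s"
  shows "Cauchy (\<lambda>n. c *\<^sub>R s n)"
  using bounded_linear.Cauchy[OF bounded_linear_scaleR_right assms] .

lemma Cauchy_uminus:
  fixes s :: "nat \<Rightarrow> 'a::real_normed_vector"
  assumes "Cauchy s"
  shows "Cauchy (\<lambda>n. - s n)"
  using Cauchy_scaleR[OF assms, of "-1"] by simp

lemma Cauchy_diff:
  fixes s t :: "nat \<Rightarrow> 'a::real_normed_vector"
  assumes "Cauchy s" "Cauchy t"
  shows "Cauchy (\<lambda>n. s n - t n)"
  using Cauchy_add[OF assms(1) Cauchy_uminus[OF assms(2)]] by simp

lemma Cauchy_norm_convergent:
  fixes s :: "nat \<Rightarrow> 'a::real_normed_vector"
  assumes "Cauchy s"
  shows "convergent (\<lambda>n. norm (s n))"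
proof -
  have "Cauchy (\<lambda>n. norm (s n))"
    unfolding Cauchy_iff
  proof (intro allI impI)
    fix e :: real assume "e > 0"
    then obtain M where "\<And>m n. m \<ge> M \<Longrightarrow> n \<ge> M \<Longrightarrow> norm (s m - s n) < e"
      using assms unfolding Cauchy_iff by blast
    then show "\<exists>M. \<forall>m\<ge>M. \<forall>n\<ge>M. norm (norm (s m) - norm (s n)) < e"
      by (metis norm_triangle_ineq3 order_le_less_trans real_norm_def)
  qed
  then show ?thesis by (rule real_Cauchy_convergent)
qed

lemma cauchy_rel_norm:
  fixes s t :: "nat \<Rightarrow> 'a::real_normed_vector"
  assumes "cauchy_rel s t"
  shows "lim (\<lambda>n. norm (s n)) = lim (\<lambda>n. norm (t n))"
proof -
  have s: "(\<lambda>n. norm (s n)) \<longlonglongrightarrow> lim (\<lambda>n. norm (s n))"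
    using assms Cauchy_norm_convergent[of s] by (simp add: cauchy_rel_def convergent_LIMSEQ_iff)
  have "(\<lambda>n. norm (s n) - norm (t n)) \<longlonglongrightarrow> 0"
    using assms unfolding cauchy_rel_def
    by (auto intro: Lim_null_comparison[of _ "\<lambda>n. norm (s n - t n)"]
        simp: norm_triangle_ineq3 tendsto_norm_zero)
  from tendsto_diff[OF s this] show ?thesis
    by (simp add: limI)
qed

instantiation completion :: (real_normed_vector) real_normed_vector
begin

lift_definition zero_completion :: "'a completion" is "\<lambda>_. 0"
  by (simp add: cauchy_rel_def Cauchy_def)

lift_definition plus_completion :: "'a completion \<Rightarrow> 'a completion \<Rightarrow> 'a completion"
  is "\<lambda>s t n. s n + t n"
proof -
  fix s s' t t' :: "nat \<Rightarrow> 'a"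
  assume "cauchy_rel s s'" "cauchy_rel t t'"
  then show "cauchy_rel (\<lambda>n. s n + t n) (\<lambda>n. s' n + t' n)"
    unfolding cauchy_rel_def
    using tendsto_add[of "\<lambda>n. s n - s' n" 0 sequentially "\<lambda>n. t n - t' n" 0]
    by (auto intro: Cauchy_add simp: algebra_simps)
qed

lift_definition uminus_completion :: "'a completion \<Rightarrow> 'a completion" is "\<lambda>s n. - s n"
proof -
  fix s s' :: "nat \<Rightarrow> 'a"
  assume "cauchy_rel s s'"
  then show "cauchy_rel (\<lambda>n. - s n) (\<lambda>n. - s' n)"
    unfolding cauchy_rel_def
    using tendsto_minus[of "\<lambda>n. s n - s' n" 0 sequentially]
    by (auto intro: Cauchy_uminus)
qed

lift_definition minus_completion :: "'a completion \<Rightarrow> 'a completion \<Rightarrow> 'a completion"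
  is "\<lambda>s t n. s n - t n"
proof -
  fix s s' t t' :: "nat \<Rightarrow> 'a"
  assume "cauchy_rel s s'" "cauchy_rel t t'"
  then show "cauchy_rel (\<lambda>n. s n - t n) (\<lambda>n. s' n - t' n)"
    unfolding cauchy_rel_def
    using tendsto_diff[of "\<lambda>n. s n - s' n" 0 sequentially "\<lambda>n. t n - t' n" 0]
    by (auto intro: Cauchy_diff simp: algebra_simps)
qed

lift_definition scaleR_completion :: "real \<Rightarrow> 'a completion \<Rightarrow> 'a completion"
  is "\<lambda>c s n. c *\<^sub>R s n"
proof -
  fix c :: real and s s' :: "nat \<Rightarrow> 'a"
  assume "cauchy_rel s s'"
  then show "cauchy_rel (\<lambda>n. c *\<^sub>R s n) (\<lambda>n. c *\<^sub>R s' n)"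
    unfolding cauchy_rel_def
    using tendsto_scaleR[OF tendsto_const[of c], of "\<lambda>n. s n - s' n" 0 sequentially]
    by (auto intro: Cauchy_scaleR simp: algebra_simps)
qed

lift_definition norm_completion :: "'a completion \<Rightarrow> real" is "\<lambda>s. lim (\<lambda>n. norm (s n))"
  by (rule cauchy_rel_norm)

definition sgn_completion :: "'a completion \<Rightarrow> 'a completion" where
  "sgn_completion x = scaleR (inverse (norm x)) x"

definition dist_completion :: "'a completion \<Rightarrow> 'a completion \<Rightarrow> real" where
  "dist_completion x y = norm (x - y)"

definition uniformity_completion :: "('a completion \<times> 'a completion) filter" where
  "uniformity_completion = (INF e\<in>{0<..}. principal {(x, y). dist x y < e})"

definition open_completion :: "'a completion set \<Rightarrow> bool" where
  "open_completion U \<longleftrightarrow> (\<forall>x\<in>U. \<forall>\<^sub>F (x', y) in uniformity. x' = x \<longrightarrow> y \<in> U)"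

instance
proof
  fix x y z :: "'a completion" and a b :: real and U :: "'a completion set"
  show "dist x y = norm (x - y)" by (rule dist_completion_def)
  show "sgn x = scaleR (inverse (norm x)) x" by (rule sgn_completion_def)
  show "uniformity = (INF e\<in>{0<..}. principal {(x, y). dist x (y :: 'a completion) < e})"
    by (rule uniformity_completion_def)
  show "open U = (\<forall>x\<in>U. \<forall>\<^sub>F (x', y) in uniformity. x' = x \<longrightarrow> y \<in> U)"
    by (rule open_completion_def)
  show "x + y + z = x + (y + z)"
    by transfer (auto simp: cauchy_rel_def algebra_simps intro: Cauchy_add)
  show "x + y = y + x"
    by transfer (auto simp: cauchy_rel_def algebra_simps intro: Cauchy_add)
  show "0 + x = x"
    by transfer (auto simp: cauchy_rel_def)
  show "- x + x = 0"
    by transfer (auto simp: cauchy_rel_def Cauchy_def)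
  show "x - y = x + - y"
    by transfer (auto simp: cauchy_rel_def intro: Cauchy_diff)
  show "a *\<^sub>R (x + y) = a *\<^sub>R x + a *\<^sub>R y"
    by transfer (auto simp: cauchy_rel_def algebra_simps intro: Cauchy_add Cauchy_scaleR)
  show "(a + b) *\<^sub>R x = a *\<^sub>R x + b *\<^sub>R x"
    by transfer (auto simp: cauchy_rel_def algebra_simps intro: Cauchy_add Cauchy_scaleR)
  show "a *\<^sub>R b *\<^sub>R x = (a * b) *\<^sub>R x"
    by transfer (auto simp: cauchy_rel_def intro: Cauchy_scaleR)
  show "1 *\<^sub>R x = x"
    by transfer (auto simp: cauchy_rel_def)
  have L: "(\<lambda>n. norm (s n)) \<longlonglongrightarrow> lim (\<lambda>n. norm (s n))" if "Cauchy s" for s :: "nat \<Rightarrow> 'a"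
    using Cauchy_norm_convergent[OF that] by (simp add: convergent_LIMSEQ_iff)
  show "(norm x = 0) = (x = 0)"
  proof (transfer, unfold cauchy_rel_def, safe)
    fix s :: "nat \<Rightarrow> 'a" assume s: "Cauchy s"
    show "Cauchy (\<lambda>_. 0 :: 'a)" by (simp add: Cauchy_def)
    assume "lim (\<lambda>n. norm (s n)) = 0"
    with L[OF s] show "(\<lambda>n. s n - 0) \<longlonglongrightarrow> 0" by (simp add: tendsto_norm_zero_iff)
  next
    fix s :: "nat \<Rightarrow> 'a" assume "(\<lambda>n. s n - 0) \<longlonglongrightarrow> 0"
    then have "(\<lambda>n. norm (s n)) \<longlonglongrightarrow> 0" by (simp add: tendsto_norm_zero)
    then show "lim (\<lambda>n. norm (s n)) = 0" by (rule limI)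
  qed
  show "norm (x + y) \<le> norm x + norm y"
  proof (transfer, unfold cauchy_rel_def, elim conjE)
    fix s t :: "nat \<Rightarrow> 'a" assume s: "Cauchy s" and t: "Cauchy t"
    show "lim (\<lambda>n. norm (s n + t n)) \<le> lim (\<lambda>n. norm (s n)) + lim (\<lambda>n. norm (t n))"
      using norm_triangle_ineq
      by (intro LIMSEQ_le[OF L[OF Cauchy_add[OF s t]] tendsto_add[OF L[OF s] L[OF t]]]) blast
  qed
  show "norm (a *\<^sub>R x) = \<bar>a\<bar> * norm x"
  proof (transfer, unfold cauchy_rel_def, elim conjE)
    fix a :: real and s :: "nat \<Rightarrow> 'a" assume s: "Cauchy s"
    show "lim (\<lambda>n. norm (a *\<^sub>R s n)) = \<bar>a\<bar> * lim (\<lambda>n. norm (s n))"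
      using tendsto_mult[OF tendsto_const[of "\<bar>a\<bar>"] L[OF s]] by (simp add: limI)
  qed
qed

end

lift_definition to_completion :: "'a::real_normed_vector \<Rightarrow> 'a completion" is "\<lambda>x _. x"
  by (simp add: cauchy_rel_def Cauchy_def)

lemma bounded_linear_to_completion: "bounded_linear to_completion"
proof (rule bounded_linear_intro)
  show "to_completion (x + y) = to_completion x + to_completion y" for x y :: 'a
    by transfer (simp add: cauchy_rel_def Cauchy_def)
  show "to_completion (r *\<^sub>R x) = r *\<^sub>R to_completion x" for r and x :: 'a
    by transfer (simp add: cauchy_rel_def Cauchy_def)
  show "norm (to_completion x) \<le> norm x * 1" for x :: 'a
    by transfer simp
qed

lemma norm_to_completion [simp]: "norm (to_completion x) = norm x"
  by transfer simp

lemma dist_to_completion [simp]: "dist (to_completion x) (to_completion y) = dist x y"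
  by (metis bounded_linear_to_completion dist_norm linear_diff
      bounded_linear.linear norm_to_completion)

lemma Cauchy_tendsto_completion:
  fixes s :: "nat \<Rightarrow> 'a::real_normed_vector"
  assumes s: "Cauchy s"
  shows "(\<lambda>n. to_completion (s n)) \<longlonglongrightarrow> abs_completion s"
  unfolding tendsto_iff
proof (intro allI impI)
  fix e :: real assume "e > 0"
  then obtain M where M: "\<And>m n. m \<ge> M \<Longrightarrow> n \<ge> M \<Longrightarrow> norm (s m - s n) < e / 2"
    using s unfolding Cauchy_iff by (meson half_gt_zero)
  have "dist (to_completion (s m)) (abs_completion s) < e" if m: "m \<ge> M" for m
  proof -
    have rel: "cauchy_rel s s" using s by (simp add: cauchy_rel_def)
    have relc: "cauchy_rel (\<lambda>_. s m) (\<lambda>_. s m)" by (simp add: cauchy_rel_def Cauchy_def)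
    have C: "Cauchy (\<lambda>n. s m - s n)" using s relc by (intro Cauchy_diff) (auto simp: cauchy_rel_def)
    then have reld: "cauchy_rel (\<lambda>n. s m - s n) (\<lambda>n. s m - s n)" by (simp add: cauchy_rel_def)
    have "dist (to_completion (s m)) (abs_completion s) = lim (\<lambda>n. norm (s m - s n))"
      unfolding dist_norm to_completion.abs_eq
        minus_completion.abs_eq[OF relc rel] norm_completion.abs_eq[OF reld] ..
    also have "\<dots> \<le> e / 2"
    proof (rule LIMSEQ_le_const2)
      show "(\<lambda>n. norm (s m - s n)) \<longlonglongrightarrow> lim (\<lambda>n. norm (s m - s n))"
        using Cauchy_norm_convergent[OF C] by (simp add: convergent_LIMSEQ_iff)
      show "\<exists>N. \<forall>n\<ge>N. norm (s m - s n) \<le> e / 2"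
        using M m by (intro exI[of _ M]) (auto intro: less_imp_le)
    qed
    finally show ?thesis using \<open>e > 0\<close> by simp
  qed
  then show "\<forall>\<^sub>F m in sequentially. dist (to_completion (s m)) (abs_completion s) < e"
    by (auto simp: eventually_sequentially)
qed

lemma dense_to_completion:
  "closure (range (to_completion :: 'a::real_normed_vector \<Rightarrow> _)) = UNIV"
proof -
  have "x \<in> closure (range to_completion)" for x :: "'a completion"
  proof (induction x rule: completion.abs_induct)
    case (1 s)
    then have "Cauchy s" by (simp add: cauchy_rel_def)
    then show ?case
      unfolding closure_sequential
      by (intro exI[of _ "\<lambda>n. to_completion (s n)"]) (simp add: Cauchy_tendsto_completion)
  qed
  then show ?thesis by blast
qed

instance completion :: (real_normed_vector) banach
proof
  fix X :: "nat \<Rightarrow> 'a completion"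
  assume X: "Cauchy X"
  have "\<exists>y. dist (to_completion y) (X n) < 1 / real (Suc n)" for n
    using dense_to_completion closure_approachable[of "X n" "range to_completion"] by auto
  then obtain y where y: "\<And>n. dist (to_completion (y n)) (X n) < 1 / real (Suc n)"
    by metis
  have "(\<lambda>n. dist (to_completion (y n)) (X n)) \<longlonglongrightarrow> 0"
    using y by (intro real_tendsto_sandwich[OF _ _ tendsto_const LIMSEQ_inverse_real_of_nat])
      (auto simp: inverse_eq_divide intro!: always_eventually less_imp_le)
  then have d: "(\<lambda>n. to_completion (y n) - X n) \<longlonglongrightarrow> 0"
    by (simp add: dist_norm tendsto_norm_zero_iff)
  have "Cauchy (\<lambda>n. (to_completion (y n) - X n) + X n)"
    by (rule Cauchy_add[OF LIMSEQ_imp_Cauchy[OF d] X])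
  then have "Cauchy y" by (simp add: Cauchy_def)
  from tendsto_diff[OF Cauchy_tendsto_completion[OF this] d]
  show "convergent X" by (auto simp: convergent_def)
qed


section \<open>Algebraic tensor product\<close>

text \<open>Finitely supported functions \<open>'k \<Rightarrow>\<^sub>0 real\<close> form the free real vector space over \<open>'k\<close>.\<close>

instantiation poly_mapping :: (type, real_vector) real_vector
begin

lift_definition scaleR_poly_mapping :: "real \<Rightarrow> ('a \<Rightarrow>\<^sub>0 'b) \<Rightarrow> ('a \<Rightarrow>\<^sub>0 'b)"
  is "\<lambda>c p k. c *\<^sub>R p k"
  by (rule finite_subset) auto

instance
  by standard (transfer; simp add: fun_eq_iff algebra_simps)+

end

inductive_set tensor_relations :: "('a::real_vector \<times> 'b::real_vector \<Rightarrow>\<^sub>0 real) set" where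
  add_left: "Poly_Mapping.single (x + x', y) 1
    - (Poly_Mapping.single (x, y) 1 + Poly_Mapping.single (x', y) 1) \<in> tensor_relations"
| add_right: "Poly_Mapping.single (x, y + y') 1
    - (Poly_Mapping.single (x, y) 1 + Poly_Mapping.single (x, y') 1) \<in> tensor_relations"
| scaleR_left: "Poly_Mapping.single (c *\<^sub>R x, y) 1
    - c *\<^sub>R Poly_Mapping.single (x, y) 1 \<in> tensor_relations"
| scaleR_right: "Poly_Mapping.single (x, c *\<^sub>R y) 1
    - c *\<^sub>R Poly_Mapping.single (x, y) 1 \<in> tensor_relations"

definition tensor_rel ::
    "('a::real_vector \<times> 'b::real_vector \<Rightarrow>\<^sub>0 real) \<Rightarrow> ('a \<times> 'b \<Rightarrow>\<^sub>0 real) \<Rightarrow> bool" where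
  "tensor_rel p q \<longleftrightarrow> p - q \<in> span tensor_relations"

lemma equivp_tensor_rel:
  "equivp (tensor_rel :: ('a::real_vector \<times> 'b::real_vector \<Rightarrow>\<^sub>0 real) \<Rightarrow> _)"
proof (rule equivpI)
  show "reflp (tensor_rel :: ('a \<times> 'b \<Rightarrow>\<^sub>0 real) \<Rightarrow> _)" by (simp add: reflp_def tensor_rel_def span_zero)
  show "symp (tensor_rel :: ('a \<times> 'b \<Rightarrow>\<^sub>0 real) \<Rightarrow> _)"
    unfolding symp_def tensor_rel_def by (metis minus_diff_eq span_neg)
  show "transp (tensor_rel :: ('a \<times> 'b \<Rightarrow>\<^sub>0 real) \<Rightarrow> _)"
  proof (rule transpI)
    fix p q r :: "'a \<times> 'b \<Rightarrow>\<^sub>0 real"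
    assume "tensor_rel p q" "tensor_rel q r"
    then have "(p - q) + (q - r) \<in> span tensor_relations"
      unfolding tensor_rel_def by (rule span_add)
    then show "tensor_rel p r" by (simp add: tensor_rel_def)
  qed
qed

quotient_type (overloaded) ('a, 'b) tensor =
    "'a::real_vector \<times> 'b::real_vector \<Rightarrow>\<^sub>0 real" / tensor_rel
  by (rule equivp_tensor_rel)

instantiation tensor :: (real_vector, real_vector) real_vector
begin

lift_definition zero_tensor :: "('a, 'b) tensor" is 0 .

lift_definition plus_tensor :: "('a, 'b) tensor \<Rightarrow> ('a, 'b) tensor \<Rightarrow> ('a, 'b) tensor" is "(+)"
  unfolding tensor_rel_def add_diff_add by (rule span_add)

lift_definition uminus_tensor :: "('a, 'b) tensor \<Rightarrow> ('a, 'b) tensor" is uminus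
  unfolding tensor_rel_def minus_diff_minus by (rule span_neg)

lift_definition minus_tensor :: "('a, 'b) tensor \<Rightarrow> ('a, 'b) tensor \<Rightarrow> ('a, 'b) tensor" is "(-)"
proof -
  fix p q p' q' :: "'a \<times> 'b \<Rightarrow>\<^sub>0 real"
  assume "tensor_rel p q" "tensor_rel p' q'"
  then have "(p - q) - (p' - q') \<in> span tensor_relations"
    unfolding tensor_rel_def by (rule span_diff)
  then show "tensor_rel (p - p') (q - q')" by (simp add: tensor_rel_def algebra_simps)
qed

lift_definition scaleR_tensor :: "real \<Rightarrow> ('a, 'b) tensor \<Rightarrow> ('a, 'b) tensor" is scaleR
  unfolding tensor_rel_def scaleR_right_diff_distrib[symmetric] by (rule span_scale)

instance
  by standard (transfer; simp add: tensor_rel_def algebra_simps span_zero)+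

end

lift_definition tprod :: "'a::real_vector \<Rightarrow> 'b::real_vector \<Rightarrow> ('a, 'b) tensor"
  is "\<lambda>x y. Poly_Mapping.single (x, y) 1" .

lemma tprod_add_left: "tprod (x + x') y = tprod x y + tprod x' y"
  by transfer (unfold tensor_rel_def, rule span_base, rule tensor_relations.add_left)

lemma tprod_add_right: "tprod x (y + y') = tprod x y + tprod x y'"
  by transfer (unfold tensor_rel_def, rule span_base, rule tensor_relations.add_right)

lemma tprod_scaleR_left: "tprod (c *\<^sub>R x) y = c *\<^sub>R tprod x y"
  by transfer (unfold tensor_rel_def, rule span_base, rule tensor_relations.scaleR_left)

lemma tprod_scaleR_right: "tprod x (c *\<^sub>R y) = c *\<^sub>R tprod x y"
  by transfer (unfold tensor_rel_def, rule span_base, rule tensor_relations.scaleR_right)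

lemma linear_tprod_left: "linear (\<lambda>x. tprod x y)"
  by (rule linearI) (simp_all add: tprod_add_left tprod_scaleR_left)

lemma linear_tprod_right: "linear (tprod x)"
  by (rule linearI) (simp_all add: tprod_add_right tprod_scaleR_right)

lemma tensor_eq_sum_tprod:
  fixes u :: "('a::real_vector, 'b::real_vector) tensor"
  shows "\<exists>(K :: ('a \<times> 'b) set) c. finite K \<and> u = (\<Sum>k\<in>K. tprod (c k *\<^sub>R fst k) (snd k))"
proof (induction u rule: tensor.abs_induct)
  case (1 p)
  have lin: "linear (abs_tensor :: ('a \<times> 'b \<Rightarrow>\<^sub>0 real) \<Rightarrow> _)"
    by (rule linearI) (simp_all add: plus_tensor.abs_eq scaleR_tensor.abs_eq)
  have gen: "abs_tensor (Poly_Mapping.single k 1) = tprod (fst k) (snd k)" for k :: "'a \<times> 'b"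
    by (simp add: tprod.abs_eq)
  have p: "p = (\<Sum>k\<in>Poly_Mapping.keys p. Poly_Mapping.lookup p k *\<^sub>R Poly_Mapping.single k 1)"
  proof (rule poly_mapping_eqI)
    fix j
    have "Poly_Mapping.lookup (\<Sum>k\<in>Poly_Mapping.keys p. Poly_Mapping.lookup p k *\<^sub>R Poly_Mapping.single k 1) j
        = (\<Sum>k\<in>Poly_Mapping.keys p. if k = j then Poly_Mapping.lookup p k else 0)"
      by (simp add: lookup_sum scaleR_poly_mapping.rep_eq lookup_single when_def if_distrib cong: if_cong)
    also have "\<dots> = Poly_Mapping.lookup p j"
      by (simp add: in_keys_iff)
    finally show "Poly_Mapping.lookup p j = Poly_Mapping.lookup (\<Sum>k\<in>Poly_Mapping.keys p. Poly_Mapping.lookup p k *\<^sub>R Poly_Mapping.single k 1) j" ..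
  qed
  have "abs_tensor p = (\<Sum>k\<in>Poly_Mapping.keys p. Poly_Mapping.lookup p k *\<^sub>R abs_tensor (Poly_Mapping.single k 1))"
    by (subst p) (simp add: linear_sum[OF lin] linear_scale[OF lin])
  also have "\<dots> = (\<Sum>k\<in>Poly_Mapping.keys p. tprod (Poly_Mapping.lookup p k *\<^sub>R fst k) (snd k))"
    by (simp add: tprod_scaleR_left gen)
  finally show ?case using finite_keys by blast
qed

lemma tensor_independent_form:
  fixes u :: "('a::real_vector, 'b::real_vector) tensor"
  shows "\<exists>(B :: 'b set) h. finite B \<and> independent B \<and> u = (\<Sum>b\<in>B. tprod (h b) b)"
proof -
  obtain K :: "('a \<times> 'b) set" and c
    where K: "finite K" and u: "u = (\<Sum>k\<in>K. tprod (c k *\<^sub>R fst k) (snd k))"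
    using tensor_eq_sum_tprod by blast
  obtain B where B: "B \<subseteq> snd ` K" "independent B" "snd ` K \<subseteq> span B"
    using maximal_independent_subset by blast
  have fin: "finite B" using B(1) K finite_subset by blast
  have rep: "(\<Sum>b\<in>B. representation B (snd k) b *\<^sub>R b) = snd k" if "k \<in> K" for k
    using that B fin by (intro sum_representation_eq) auto
  have "u = (\<Sum>k\<in>K. tprod (c k *\<^sub>R fst k) (\<Sum>b\<in>B. representation B (snd k) b *\<^sub>R b))"
    unfolding u by (rule sum.cong) (simp_all add: rep)
  also have "\<dots> = (\<Sum>k\<in>K. \<Sum>b\<in>B. tprod (representation B (snd k) b *\<^sub>R c k *\<^sub>R fst k) b)"
    by (simp add: linear_sum[OF linear_tprod_right] tprod_scaleR_right tprod_scaleR_left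
        scaleR_sum_right mult.commute)
  also have "\<dots> = (\<Sum>b\<in>B. \<Sum>k\<in>K. tprod (representation B (snd k) b *\<^sub>R c k *\<^sub>R fst k) b)"
    by (rule sum.swap)
  also have "\<dots> = (\<Sum>b\<in>B. tprod (\<Sum>k\<in>K. representation B (snd k) b *\<^sub>R c k *\<^sub>R fst k) b)"
    by (simp only: linear_sum[OF linear_tprod_left])
  finally show ?thesis using fin B(2) by (intro exI[of _ B] exI conjI)
qed


section \<open>Injective norm and injective tensor product\<close>

definition free_extend :: "('k \<Rightarrow> real) \<Rightarrow> ('k \<Rightarrow>\<^sub>0 real) \<Rightarrow> real" where
  "free_extend h p = (\<Sum>k\<in>Poly_Mapping.keys p. Poly_Mapping.lookup p k * h k)"

lemma free_extend_single [simp]: "free_extend h (Poly_Mapping.single k c) = c * h k"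
  by (simp add: free_extend_def)

lemma linear_free_extend: "linear (free_extend h)"
proof (rule linearI)
  have ext: "free_extend h p = (\<Sum>k\<in>A. Poly_Mapping.lookup p k * h k)"
    if "finite A" "Poly_Mapping.keys p \<subseteq> A" for p :: "'a \<Rightarrow>\<^sub>0 real" and A
    unfolding free_extend_def using that by (intro sum.mono_neutral_left) (auto simp: in_keys_iff)
  fix p q :: "'a \<Rightarrow>\<^sub>0 real" and c :: real
  let ?A = "Poly_Mapping.keys p \<union> Poly_Mapping.keys q"
  have "Poly_Mapping.keys (p + q) \<subseteq> ?A" by (rule Poly_Mapping.keys_add)
  then show "free_extend h (p + q) = free_extend h p + free_extend h q"
    by (simp add: ext[of ?A] lookup_add distrib_right sum.distrib)
  have "Poly_Mapping.keys (c *\<^sub>R p) \<subseteq> Poly_Mapping.keys p"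
    by (auto simp: in_keys_iff scaleR_poly_mapping.rep_eq)
  then show "free_extend h (c *\<^sub>R p) = c *\<^sub>R free_extend h p"
    by (simp add: ext[of "Poly_Mapping.keys p"] scaleR_poly_mapping.rep_eq sum_distrib_left mult.assoc)
qed

text \<open>\<open>tensor_eval f g\<close> is the functional \<open>f \<otimes> g\<close> on the algebraic tensor product.\<close>

lift_definition tensor_eval ::
    "('a::real_normed_vector \<Rightarrow>\<^sub>L real) \<Rightarrow> ('b::real_normed_vector \<Rightarrow>\<^sub>L real) \<Rightarrow> ('a, 'b) tensor \<Rightarrow> real"
  is "\<lambda>f g. free_extend (\<lambda>(x, y). blinfun_apply f x * blinfun_apply g y)"
proof -
  fix f :: "'a \<Rightarrow>\<^sub>L real" and g :: "'b \<Rightarrow>\<^sub>L real" and p q :: "'a \<times> 'b \<Rightarrow>\<^sub>0 real"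
  let ?E = "free_extend (\<lambda>(x, y). blinfun_apply f x * blinfun_apply g y)"
  note lin = linear_free_extend[of "\<lambda>(x, y). blinfun_apply f x * blinfun_apply g y"]
  assume "tensor_rel p q"
  then have "p - q \<in> span tensor_relations" by (simp add: tensor_rel_def)
  moreover have "?E r = 0" if "r \<in> tensor_relations" for r
    using that
    by induction (simp_all add: linear_diff[OF lin] linear_add[OF lin] linear_scale[OF lin]
        blinfun.add_right blinfun.scaleR_right algebra_simps)
  ultimately have "?E (p - q) = 0" by (rule linear_eq_0_on_span[OF lin, rotated])
  then show "?E p = ?E q" by (simp add: linear_diff[OF lin])
qed

lemma linear_tensor_eval: "linear (tensor_eval f g)"
proof (rule linearI)
  show "tensor_eval f g (u + v) = tensor_eval f g u + tensor_eval f g v" for u v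
    by transfer (rule linear_add[OF linear_free_extend])
  show "tensor_eval f g (c *\<^sub>R u) = c *\<^sub>R tensor_eval f g u" for c u
    by transfer (rule linear_scale[OF linear_free_extend])
qed

lemma tensor_eval_tprod [simp]: "tensor_eval f g (tprod x y) = f x * g y"
  unfolding tprod.abs_eq tensor_eval.abs_eq by simp

lemma tensor_eval_sum:
  "tensor_eval f g (\<Sum>i\<in>I. tprod (x i) (y i)) = (\<Sum>i\<in>I. f (x i) * g (y i))"
  by (simp add: linear_sum[OF linear_tensor_eval])

lemma tensor_eval_scale: "tensor_eval (r *\<^sub>R f) (s *\<^sub>R g) u = r * s * tensor_eval f g u"
proof -
  obtain K c where u: "u = (\<Sum>k\<in>K. tprod (c k *\<^sub>R fst k) (snd k))"
    using tensor_eq_sum_tprod by blast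
  show ?thesis
    unfolding u tensor_eval_sum sum_distrib_left
    by (rule sum.cong) (simp_all add: blinfun.scaleR_left)
qed

lemma tensor_eval_eq_0_imp:
  assumes "\<And>f g. tensor_eval f g u = 0"
  shows "u = 0"
proof -
  obtain B h where B: "finite B" "independent B" and u: "u = (\<Sum>b\<in>B. tprod (h b) b)"
    using tensor_independent_form by blast
  have "h b = 0" if "b \<in> B" for b
  proof (rule functionals_separate_points)
    fix f :: "'a \<Rightarrow>\<^sub>L real"
    have "(\<Sum>b\<in>B. f (h b) *\<^sub>R b) = 0"
    proof (rule functionals_separate_points)
      fix g :: "'b \<Rightarrow>\<^sub>L real"
      show "g (\<Sum>b\<in>B. f (h b) *\<^sub>R b) = 0"
        using assms[of f g] unfolding u tensor_eval_sum
        by (simp add: blinfun.sum_right blinfun.scaleR_right)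
    qed
    then show "f (h b) = 0"
      using independentD[OF B(2) B(1) order_refl, where u = "\<lambda>b. blinfun_apply f (h b)"] that
      by simp
  qed
  then show "u = 0" unfolding u
    by (intro sum.neutral) (metis tprod_scaleR_left scaleR_zero_left)
qed

lemma bdd_above_tensor_eval:
  "bdd_above {\<bar>tensor_eval f g u\<bar> | f g. norm f = 1 \<and> norm g = 1}"
proof -
  obtain K c where u: "u = (\<Sum>k\<in>K. tprod (c k *\<^sub>R fst k) (snd k))"
    using tensor_eq_sum_tprod by blast
  have "\<bar>tensor_eval f g u\<bar> \<le> (\<Sum>k\<in>K. norm (c k *\<^sub>R fst k) * norm (snd k))"
    if "norm f = 1" "norm g = 1" for f g
    unfolding u tensor_eval_sum
  proof (rule order_trans[OF sum_abs], rule sum_mono)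
    fix k
    show "\<bar>f (c k *\<^sub>R fst k) * g (snd k)\<bar> \<le> norm (c k *\<^sub>R fst k) * norm (snd k)"
      unfolding abs_mult using norm_blinfun[of f "c k *\<^sub>R fst k"] norm_blinfun[of g "snd k"] that
      by (intro mult_mono) (simp_all del: norm_scaleR)
  qed
  then show ?thesis by (intro bdd_aboveI) blast
qed

instantiation tensor :: (real_normed_vector, real_normed_vector) real_normed_vector
begin

text \<open>
  The supremum over the dual unit spheres. The element \<open>0\<close> only matters when one of the factors
  is trivial and its dual has an empty unit sphere; see \<open>norm_sum_tprod\<close> below.
\<close>

definition norm_tensor :: "('a, 'b) tensor \<Rightarrow> real" where
  "norm_tensor u = Sup (insert 0 {\<bar>tensor_eval f g u\<bar> | f g. norm f = 1 \<and> norm g = 1})"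

definition sgn_tensor :: "('a, 'b) tensor \<Rightarrow> ('a, 'b) tensor" where
  "sgn_tensor x = scaleR (inverse (norm x)) x"

definition dist_tensor :: "('a, 'b) tensor \<Rightarrow> ('a, 'b) tensor \<Rightarrow> real" where
  "dist_tensor x y = norm (x - y)"

definition uniformity_tensor :: "(('a, 'b) tensor \<times> ('a, 'b) tensor) filter" where
  "uniformity_tensor = (INF e\<in>{0<..}. principal {(x, y). dist x y < e})"

definition open_tensor :: "('a, 'b) tensor set \<Rightarrow> bool" where
  "open_tensor U \<longleftrightarrow> (\<forall>x\<in>U. \<forall>\<^sub>F (x', y) in uniformity. x' = x \<longrightarrow> y \<in> U)"

instance
proof
  fix x y :: "('a, 'b) tensor" and a :: real and U :: "('a, 'b) tensor set"
  show "dist x y = norm (x - y)" by (rule dist_tensor_def)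
  show "sgn x = scaleR (inverse (norm x)) x" by (rule sgn_tensor_def)
  show "uniformity = (INF e\<in>{0<..}. principal {(x, y). dist x (y :: ('a, 'b) tensor) < e})"
    by (rule uniformity_tensor_def)
  show "open U = (\<forall>x\<in>U. \<forall>\<^sub>F (x', y) in uniformity. x' = x \<longrightarrow> y \<in> U)"
    by (rule open_tensor_def)
  have bdd: "bdd_above (insert 0 {\<bar>tensor_eval f g u\<bar> | f g. norm f = 1 \<and> norm g = 1})"
    for u :: "('a, 'b) tensor"
    using bdd_above_tensor_eval[of u] by simp
  have nonneg: "0 \<le> norm u" for u :: "('a, 'b) tensor"
    unfolding norm_tensor_def using bdd by (rule cSup_upper[rotated]) simp
  have upper: "\<bar>tensor_eval f g u\<bar> \<le> norm u" if "norm f = 1" "norm g = 1"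
    for f g and u :: "('a, 'b) tensor"
    unfolding norm_tensor_def using bdd by (rule cSup_upper[rotated]) (use that in blast)
  have least: "norm u \<le> C"
    if "0 \<le> C" "\<And>f g. norm f = 1 \<Longrightarrow> norm g = 1 \<Longrightarrow> \<bar>tensor_eval f g u\<bar> \<le> C"
    for C and u :: "('a, 'b) tensor"
    unfolding norm_tensor_def using that by (intro cSup_least) auto
  show "norm x = 0 \<longleftrightarrow> x = 0"
  proof
    assume n: "norm x = 0"
    show "x = 0"
    proof (rule tensor_eval_eq_0_imp)
      fix f :: "'a \<Rightarrow>\<^sub>L real" and g :: "'b \<Rightarrow>\<^sub>L real"
      show "tensor_eval f g x = 0"
      proof (cases "f = 0 \<or> g = 0")
        case True
        then show ?thesis
          using tensor_eval_scale[of 0 f 1 g x] tensor_eval_scale[of 1 f 0 g x] by auto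
      next
        case False
        then have "\<bar>tensor_eval (f /\<^sub>R norm f) (g /\<^sub>R norm g) x\<bar> \<le> norm x"
          by (intro upper) auto
        with False n show ?thesis by (simp add: tensor_eval_scale)
      qed
    qed
  next
    assume "x = 0"
    then have "norm x \<le> 0" by (intro least) (simp_all add: linear_0[OF linear_tensor_eval])
    with nonneg[of x] show "norm x = 0" by simp
  qed
  show "norm (x + y) \<le> norm x + norm y"
  proof (rule least)
    fix f :: "'a \<Rightarrow>\<^sub>L real" and g :: "'b \<Rightarrow>\<^sub>L real" assume "norm f = 1" "norm g = 1"
    then show "\<bar>tensor_eval f g (x + y)\<bar> \<le> norm x + norm y"
      using upper[of f g x] upper[of f g y] by (simp add: linear_add[OF linear_tensor_eval])
  qed (simp add: nonneg)
  have le: "norm (a *\<^sub>R u) \<le> \<bar>a\<bar> * norm u" for a and u :: "('a, 'b) tensor"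
    by (rule least)
      (simp_all add: linear_scale[OF linear_tensor_eval] nonneg abs_mult mult_left_mono upper)
  show "norm (a *\<^sub>R x) = \<bar>a\<bar> * norm x"
  proof (cases "a = 0")
    case True
    then show ?thesis using le[of 0 x] nonneg[of "0 *\<^sub>R x"] by simp
  next
    case False
    then have "\<bar>a\<bar> * norm x \<le> norm (a *\<^sub>R x)"
      using le[of "inverse a" "a *\<^sub>R x"] by (simp add: field_simps)
    with le[of a x] show ?thesis by simp
  qed
qed

end

lemma norm_sum_tprod:
  fixes x :: "'i \<Rightarrow> 'a::real_normed_vector" and y :: "'i \<Rightarrow> 'b::real_normed_vector"
  assumes "\<exists>a::'a. a \<noteq> 0" and "\<exists>b::'b. b \<noteq> 0"
  shows "norm (\<Sum>i\<in>I. tprod (x i) (y i))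
    = (SUP (f, g)\<in>sphere (0 :: 'a \<Rightarrow>\<^sub>L real) 1 \<times> sphere (0 :: 'b \<Rightarrow>\<^sub>L real) 1.
        \<bar>\<Sum>i\<in>I. blinfun_apply f (x i) * blinfun_apply g (y i)\<bar>)"
proof -
  let ?u = "\<Sum>i\<in>I. tprod (x i) (y i)"
  let ?A = "{\<bar>tensor_eval f g ?u\<bar> | f g. norm f = 1 \<and> norm g = 1}"
  obtain a :: 'a and b :: 'b where "a \<noteq> 0" "b \<noteq> 0" using assms by blast
  then obtain f0 :: "'a \<Rightarrow>\<^sub>L real" and g0 :: "'b \<Rightarrow>\<^sub>L real" where "norm f0 = 1" "norm g0 = 1"
    using exists_norming_functional[of a] exists_norming_functional[of b] by blast
  then have mem: "\<bar>tensor_eval f0 g0 ?u\<bar> \<in> ?A" by blast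
  have bdd: "bdd_above ?A" by (rule bdd_above_tensor_eval)
  have "0 \<le> \<bar>tensor_eval f0 g0 ?u\<bar>" by simp
  also have "\<dots> \<le> Sup ?A" using mem bdd by (rule cSup_upper)
  finally have sup: "Sup (insert 0 ?A) = Sup ?A"
    using mem bdd by (subst cSup_insert) (auto simp: sup_absorb2)
  have A: "?A = (\<lambda>(f, g). \<bar>\<Sum>i\<in>I. blinfun_apply f (x i) * blinfun_apply g (y i)\<bar>) `
      (sphere (0 :: 'a \<Rightarrow>\<^sub>L real) 1 \<times> sphere (0 :: 'b \<Rightarrow>\<^sub>L real) 1)"
    unfolding tensor_eval_sum by (auto simp: image_iff) blast
  show ?thesis unfolding norm_tensor_def sup unfolding A ..
qed

type_synonym ('a, 'b) injective_tensor = "('a, 'b) tensor completion"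


section \<open>Diametral and Daugavet-type properties\<close>

definition slices :: "'z::real_normed_vector set set" where
  "slices = {{z \<in> cball 0 1. blinfun_apply f z > (SUP v\<in>cball 0 1. blinfun_apply f v) - \<alpha>}
     | (f :: 'z \<Rightarrow>\<^sub>L real) \<alpha>. \<alpha> > 0}"

definition WODP :: "'z::banach itself \<Rightarrow> bool" where
  "WODP _ \<longleftrightarrow>
    (\<forall>n\<ge>1. \<forall>(x :: nat \<Rightarrow> 'z) \<epsilon>. \<forall>S\<in>slices. \<forall>z'\<in>cball 0 1.
      (\<forall>i\<in>{1..n}. x i \<in> sphere 0 1) \<longrightarrow> \<epsilon> > 0 \<longrightarrow>
      (\<exists>z\<in>S. \<exists>T :: 'z \<Rightarrow>\<^sub>L 'z.
        norm T \<le> 1 + \<epsilon> \<and> (\<forall>i\<in>{1..n}. norm (blinfun_apply T (x i) - x i) < \<epsilon>) \<and>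
        norm (blinfun_apply T z - z') < \<epsilon>))"

definition weak_topology :: "'z::real_normed_vector topology" where
  "weak_topology = topology_generated_by {blinfun_apply f -` U | (f :: 'z \<Rightarrow>\<^sub>L real) U. open U}"

definition DD2P :: "'z::banach itself \<Rightarrow> bool" where
  "DD2P _ \<longleftrightarrow>
    (\<forall>W. openin (subtopology weak_topology (cball (0 :: 'z) 1)) W \<longrightarrow> W \<noteq> {} \<longrightarrow>
      (\<forall>z\<in>W \<inter> sphere 0 1. \<forall>\<epsilon>>0. \<exists>w\<in>W. norm (w - z) > 2 - \<epsilon>))"

end

theory Submission
  imports Defs
begin

text \<open>
  Let \<open>z\<close> be a unit vector of \<open>X \<otimes>\<^sub>\<epsilon> Y\<close>, to be moved by almost \<open>2\<close> while finitely many functionals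
  \<open>\<phi>\<close> hardly change. By density \<open>z\<close> is approximated by an algebraic tensor \<open>u = \<Sum>b\<in>B. x b \<otimes> b\<close>
  with \<open>B\<close> finite and independent. Choose norm-one functionals \<open>f\<close>, \<open>g\<close> with
  \<open>(f \<otimes> g) u \<approx> 1\<close>, and contract \<open>u\<close> along \<open>g\<close> to the vector \<open>x0 = \<Sum>b\<in>B. g b x b\<close> of \<open>X\<close>, so
  that \<open>f x0 \<approx> 1\<close>.

  The vector \<open>x0\<close> is a functional on \<open>X*\<close> and cuts a slice off its unit ball. The WODP of \<open>X*\<close>
  provides \<open>h\<close> in this slice and an operator \<open>T\<close> on \<open>X*\<close>, of norm almost \<open>1\<close>, which almost fixes
  the functionals \<open>\<phi>(\<cdot> \<otimes> b)\<close> and sends \<open>h\<close> almost to \<open>- f\<close>. Then \<open>(T* \<otimes> id) u\<close> is the tensor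
  wanted: it has norm almost at most \<open>1\<close>, the \<open>\<phi>\<close> take almost the same values at it as at \<open>u\<close>, and
  \<open>h \<otimes> g\<close> takes at it the value \<open>(T h) x0 \<approx> - f x0 \<approx> - 1\<close>, whereas \<open>(h \<otimes> g) u = h x0 \<approx> 1\<close>.
  However, it lives in \<open>X** \<otimes> Y\<close>.

  The substitute inside \<open>X \<otimes> Y\<close> is found by a local reflexivity argument,
  \<open>tensor_moved_by_dual_operator\<close>: some \<open>w \<in> X \<otimes> Y\<close>, of norm arbitrarily close to
  \<open>\<parallel>T\<parallel> \<parallel>u\<parallel>\<close>, takes the same values as \<open>(T* \<otimes> id) u\<close> at finitely many given functionals. By Helly's
  theorem (\<open>Helly_linear_image\<close>) this reduces to a norm estimate for functionals on
  \<open>X \<otimes> span B\<close>. As \<open>span B\<close> is finite-dimensional, \<open>X \<otimes> span B\<close> embeds almost isometrically into a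
  finite \<open>\<ell>\<^sub>\<infinity>\<close>-sum of copies of \<open>X\<close> (\<open>finite_norming_family\<close>), whose functionals are
  \<open>\<ell>\<^sub>1\<close>-sums of elements of \<open>X*\<close> (\<open>functional_on_sup_sum\<close>). On such a sum \<open>T\<close> acts coordinatewise,
  and the estimate is immediate.
\<close>

section \<open>Helly's theorem\<close>

text \<open>
  By induction on the number of functionals: subtracting from \<open>f\<close> a multiple of the last \<open>\<phi> j\<close>
  makes it vanish on the common kernel of the remaining ones.
\<close>

lemma linear_functional_in_span:
  fixes \<phi> :: "'j \<Rightarrow> 'v::real_vector \<Rightarrow> real"
  assumes "finite J" and "\<And>j. j \<in> J \<Longrightarrow> linear (\<phi> j)" and "linear f"
    and "\<And>v. (\<And>j. j \<in> J \<Longrightarrow> \<phi> j v = 0) \<Longrightarrow> f v = 0"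
  shows "\<exists>a. \<forall>v. f v = (\<Sum>j\<in>J. a j * \<phi> j v)"
  using assms
proof (induction J arbitrary: f rule: finite_induct)
  case empty
  then show ?case by simp
next
  case (insert j J)
  have lin: "linear (\<phi> j)" using insert.prems(1) by simp
  show ?case
  proof (cases "\<forall>v. (\<forall>i\<in>J. \<phi> i v = 0) \<longrightarrow> \<phi> j v = 0")
    case True
    have "\<exists>a. \<forall>v. f v = (\<Sum>i\<in>J. a i * \<phi> i v)"
      using True insert.prems by (intro insert.IH) auto
    then obtain a where a: "\<forall>v. f v = (\<Sum>i\<in>J. a i * \<phi> i v)" by blast
    have "(\<Sum>i\<in>insert j J. (a(j := 0)) i * \<phi> i v) = (\<Sum>i\<in>J. a i * \<phi> i v)" for v
      using insert.hyps by (simp, intro sum.cong) auto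
    with a show ?thesis by (intro exI[of _ "a(j := 0)"]) simp
  next
    case False
    then obtain v1 where v1: "\<And>i. i \<in> J \<Longrightarrow> \<phi> i v1 = 0" "\<phi> j v1 \<noteq> 0" by blast
    let ?f = "\<lambda>v. f v - f v1 / \<phi> j v1 * \<phi> j v"
    have "linear ?f"
      using linear_compose_sub[OF insert.prems(2) linear_compose_scale_right[OF lin, of "f v1 / \<phi> j v1"]]
      by simp
    moreover have "?f v = 0" if v: "\<And>i. i \<in> J \<Longrightarrow> \<phi> i v = 0" for v
    proof -
      let ?v = "v - (\<phi> j v / \<phi> j v1) *\<^sub>R v1"
      have "\<phi> i ?v = 0" if i: "i \<in> insert j J" for i
      proof -
        have "linear (\<phi> i)" using insert.prems(1) i by blast
        then have "\<phi> i ?v = \<phi> i v - \<phi> j v / \<phi> j v1 * \<phi> i v1"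
          by (simp add: linear_diff linear_scale)
        then show ?thesis using i v v1 by auto
      qed
      then have "f ?v = 0" using insert.prems(3) by blast
      then show ?thesis
        using insert.prems(2) by (simp add: linear_diff linear_scale)
    qed
    ultimately have "\<exists>a. \<forall>v. ?f v = (\<Sum>i\<in>J. a i * \<phi> i v)"
      using insert.prems(1) by (intro insert.IH) auto
    then obtain a where a: "\<And>v. ?f v = (\<Sum>i\<in>J. a i * \<phi> i v)" by blast
    have eq: "(\<Sum>i\<in>insert j J. (a(j := f v1 / \<phi> j v1)) i * \<phi> i v)
        = f v1 / \<phi> j v1 * \<phi> j v + (\<Sum>i\<in>J. a i * \<phi> i v)" for v
      using insert.hyps by simp (intro sum.cong, auto)
    have "f v = (\<Sum>i\<in>insert j J. (a(j := f v1 / \<phi> j v1)) i * \<phi> i v)" for v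
      unfolding eq using a[of v] by simp
    then show ?thesis by blast
  qed
qed

text \<open>
  The hypothesis says that the right-hand sides respect every linear relation between the
  functionals. In the induction, a new functional is either a combination of the previous ones,
  and then its equation follows from theirs, or it is nonzero at some common zero of these, along
  which a previous solution can be corrected.
\<close>

lemma functional_equations_solvable:
  fixes \<phi> :: "'j \<Rightarrow> 'v::real_vector \<Rightarrow> real"
  assumes "finite J" and "\<And>j. j \<in> J \<Longrightarrow> linear (\<phi> j)"
    and "\<And>a. (\<And>v. (\<Sum>j\<in>J. a j * \<phi> j v) = 0) \<Longrightarrow> (\<Sum>j\<in>J. a j * c j) = 0"
  shows "\<exists>v. \<forall>j\<in>J. \<phi> j v = c j"
  using assms
proof (induction J rule: finite_induct)
  case empty
  then show ?case by simp
next
  case (insert j J)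
  have upd: "(\<Sum>i\<in>insert j J. (a(j := r)) i * s i) = r * s j + (\<Sum>i\<in>J. a i * s i)"
    for a s :: "'j \<Rightarrow> real" and r
    using insert.hyps by simp (intro sum.cong, auto)
  have "\<exists>v. \<forall>i\<in>J. \<phi> i v = c i"
  proof (rule insert.IH)
    fix a assume "\<And>v. (\<Sum>i\<in>J. a i * \<phi> i v) = 0"
    then show "(\<Sum>i\<in>J. a i * c i) = 0"
      using insert.prems(2)[of "a(j := 0)"] unfolding upd by simp
  qed (use insert.prems in auto)
  then obtain v where v: "\<And>i. i \<in> J \<Longrightarrow> \<phi> i v = c i" by blast
  show ?case
  proof (cases "\<forall>v. (\<forall>i\<in>J. \<phi> i v = 0) \<longrightarrow> \<phi> j v = 0")
    case True
    have "\<exists>a. \<forall>v. \<phi> j v = (\<Sum>i\<in>J. a i * \<phi> i v)"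
      using True insert by (intro linear_functional_in_span) auto
    then obtain a where a: "\<And>v. \<phi> j v = (\<Sum>i\<in>J. a i * \<phi> i v)" by blast
    have "(\<Sum>i\<in>insert j J. (a(j := -1)) i * c i) = 0"
      by (rule insert.prems(2)) (simp only: upd, simp add: a)
    then have "c j = (\<Sum>i\<in>J. a i * c i)" unfolding upd by simp
    also have "\<dots> = \<phi> j v" unfolding a by (intro sum.cong) (simp_all add: v)
    finally show ?thesis using v by (intro exI[of _ v]) auto
  next
    case False
    then obtain v1 where v1: "\<And>i. i \<in> J \<Longrightarrow> \<phi> i v1 = 0" "\<phi> j v1 \<noteq> 0" by blast
    let ?v = "v + ((c j - \<phi> j v) / \<phi> j v1) *\<^sub>R v1"
    have "\<phi> i ?v = c i" if i: "i \<in> insert j J" for i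
    proof -
      have "linear (\<phi> i)" using insert.prems(1) i by blast
      then have "\<phi> i ?v = \<phi> i v + (c j - \<phi> j v) / \<phi> j v1 * \<phi> i v1"
        by (simp add: linear_add linear_scale)
      then show ?thesis using i v v1 by auto
    qed
    then show ?thesis by blast
  qed
qed

text \<open>
  Hahn--Banach extension of the functional \<open>n + t v \<mapsto> t M\<close>, which has norm at most \<open>1\<close>
  because \<open>v\<close> has distance at least \<open>M\<close> from \<open>N\<close>.
\<close>

lemma functional_vanishing_on_subspace:
  fixes N :: "'l::real_normed_vector set"
  assumes N: "subspace N" and M: "M \<ge> 0" and far: "\<And>n. n \<in> N \<Longrightarrow> M \<le> norm (v - n)"
  shows "\<exists>F :: 'l \<Rightarrow>\<^sub>L real. norm F \<le> 1 \<and> (\<forall>n\<in>N. blinfun_apply F n = 0) \<and> blinfun_apply F v = M"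
proof -
  let ?G = "{p + q |p q. p \<in> N \<times> {0::real} \<and> q \<in> span {(v, M)}}"
  have N0: "subspace (N \<times> {0::real})"
    using N by (auto simp: subspace_def zero_prod_def)
  have "\<exists>F :: 'l \<Rightarrow>\<^sub>L real. norm F \<le> 1 \<and> (\<forall>(x, r)\<in>?G. blinfun_apply F x = r)"
  proof (rule hahn_banach_graph)
    show "subspace ?G" by (intro subspace_sums N0 subspace_span)
    fix p assume "p \<in> ?G"
    then obtain n t where n: "n \<in> N" and p: "p = (n + t *\<^sub>R v, t * M)"
      unfolding span_singleton by auto
    show "snd p \<le> norm (fst p)"
    proof (cases "t > 0")
      case True
      have "(- (1 / t)) *\<^sub>R n \<in> N" using N n by (rule subspace_scale)
      from far[OF this] have "t * M \<le> t * norm (v + (1 / t) *\<^sub>R n)"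
        using True by simp
      also have "\<dots> = norm (t *\<^sub>R (v + (1 / t) *\<^sub>R n))" using True by simp
      also have "t *\<^sub>R (v + (1 / t) *\<^sub>R n) = n + t *\<^sub>R v"
        using True by (simp add: scaleR_add_right)
      finally show ?thesis by (simp add: p)
    next
      case False
      then have "t * M \<le> 0" using M by (simp add: mult_nonpos_nonneg)
      then show ?thesis using norm_ge_zero[of "n + t *\<^sub>R v"] by (simp add: p del: norm_ge_zero)
    qed
  qed
  then obtain F :: "'l \<Rightarrow>\<^sub>L real" where F: "norm F \<le> 1" "\<forall>(x, r)\<in>?G. blinfun_apply F x = r" by blast
  have "(n, 0) \<in> ?G" if "n \<in> N" for n
    using that span_zero[of "{(v, M)}"]
    by (intro CollectI exI[of _ "(n, 0)"] exI[of _ 0]) auto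
  moreover have "(v, M) \<in> ?G"
    using span_base[of "(v, M)" "{(v, M)}"] subspace_0[OF N]
    by (intro CollectI exI[of _ "(0, 0)"] exI[of _ "(v, M)"]) auto
  ultimately show ?thesis using F by (intro exI[of _ F]) fastforce
qed

text \<open>
  The usual theorem is the case where \<open>\<iota>\<close> is the identity. Here the unknown ranges over a space
  without norm and its size is measured after the map \<open>\<iota>\<close>, so that the dual condition concerns
  functionals \<open>F\<close> on the whole target space instead of functionals on the image of \<open>\<iota>\<close>.

  If every solution were large, some \<open>F\<close> would vanish on the image of the solutions of the
  homogeneous system without being small at a particular solution; then \<open>F \<circ> \<iota>\<close> is a combination of
  the \<open>\<phi> j\<close>, and the dual condition is violated.
\<close>

theorem Helly_linear_image:
  fixes \<iota> :: "'v::real_vector \<Rightarrow> 'l::real_normed_vector" and \<phi> :: "'j \<Rightarrow> 'v \<Rightarrow> real"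
  assumes J: "finite J" and lin: "\<And>j. j \<in> J \<Longrightarrow> linear (\<phi> j)" and \<iota>: "linear \<iota>"
    and bound: "\<And>(F :: 'l \<Rightarrow>\<^sub>L real) a. (\<And>v. blinfun_apply F (\<iota> v) = (\<Sum>j\<in>J. a j * \<phi> j v))
      \<Longrightarrow> (\<Sum>j\<in>J. a j * c j) \<le> M * norm F"
    and M: "0 \<le> M" "M < M'"
  shows "\<exists>v. (\<forall>j\<in>J. \<phi> j v = c j) \<and> norm (\<iota> v) < M'"
proof (rule ccontr)
  assume contra: "\<not> ?thesis"
  have "\<exists>v. \<forall>j\<in>J. \<phi> j v = c j"
  proof (rule functional_equations_solvable[OF J lin])
    fix a assume a: "\<And>v. (\<Sum>j\<in>J. a j * \<phi> j v) = 0"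
    have "(\<Sum>j\<in>J. a j * c j) \<le> M * norm (0 :: 'l \<Rightarrow>\<^sub>L real)"
      using a by (intro bound) simp
    moreover have "(\<Sum>j\<in>J. (- a j) * c j) \<le> M * norm (0 :: 'l \<Rightarrow>\<^sub>L real)"
      using a by (intro bound) (simp add: sum_negf)
    ultimately show "(\<Sum>j\<in>J. a j * c j) = 0" by (simp add: sum_negf)
  qed
  then obtain v0 where v0: "\<And>j. j \<in> J \<Longrightarrow> \<phi> j v0 = c j" by blast
  let ?K = "{v. \<forall>j\<in>J. \<phi> j v = 0}"
  have "subspace ?K" unfolding subspace_def
    using lin by (simp add: linear_0 linear_add linear_scale)
  then have "subspace (\<iota> ` ?K)" by (rule linear_subspace_image[OF \<iota>])
  moreover have "M' \<le> norm (\<iota> v0 - n)" if "n \<in> \<iota> ` ?K" for n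
  proof -
    from that obtain k where "n = \<iota> k" "k \<in> ?K" by (rule imageE)
    then have k: "n = \<iota> k" "\<And>j. j \<in> J \<Longrightarrow> \<phi> j k = 0" by simp_all
    have "\<forall>j\<in>J. \<phi> j (v0 - k) = c j" using lin v0 k by (simp add: linear_diff)
    then have "\<not> norm (\<iota> (v0 - k)) < M'" using contra by blast
    then show ?thesis by (simp add: k linear_diff[OF \<iota>])
  qed
  ultimately have "\<exists>F :: 'l \<Rightarrow>\<^sub>L real. norm F \<le> 1 \<and> (\<forall>n\<in>\<iota> ` ?K. blinfun_apply F n = 0) \<and> blinfun_apply F (\<iota> v0) = M'"
    using M by (intro functional_vanishing_on_subspace) auto
  then obtain F :: "'l \<Rightarrow>\<^sub>L real"
    where F: "norm F \<le> 1" "\<And>k. k \<in> ?K \<Longrightarrow> F (\<iota> k) = 0" "F (\<iota> v0) = M'" by blast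
  have "linear (\<lambda>v. F (\<iota> v))"
    using linear_compose[OF \<iota> bounded_linear.linear[OF blinfun.bounded_linear_right[of F]]]
    by (simp add: o_def)
  then have "\<exists>a. \<forall>v. F (\<iota> v) = (\<Sum>j\<in>J. a j * \<phi> j v)"
    using F(2) by (intro linear_functional_in_span[OF J lin]) auto
  then obtain a where a: "\<And>v. F (\<iota> v) = (\<Sum>j\<in>J. a j * \<phi> j v)" by blast
  have "M' = (\<Sum>j\<in>J. a j * \<phi> j v0)" using F(3) a by simp
  also have "\<dots> = (\<Sum>j\<in>J. a j * c j)" by (intro sum.cong) (simp_all add: v0)
  also have "\<dots> \<le> M * norm F" using a by (rule bound)
  also have "\<dots> \<le> M * 1" using F(1) M(1) by (rule mult_left_mono)
  finally show False using M by simp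
qed

section \<open>Functionals on finite sup-sums\<close>

text \<open>
  The \<open>\<ell>\<^sub>\<infinity>\<close>-sum of \<open>N\<close> copies of \<open>'a\<close>, with \<open>N\<close> an arbitrary number, is realised
  as the sequences vanishing from \<open>N\<close> on, inside the bounded functions on the discrete space \<open>nat\<close>.
\<close>

definition sup_sum_vector :: "nat \<Rightarrow> (nat \<Rightarrow> 'a::real_normed_vector) \<Rightarrow> nat \<Rightarrow>\<^sub>C 'a" where
  "sup_sum_vector N x = Bcontfun (\<lambda>k. if k < N then x k else 0)"

lemma apply_sup_sum_vector:
  "apply_bcontfun (sup_sum_vector N x) = (\<lambda>k. if k < N then x k else 0)"
proof -
  have "range (\<lambda>k. if k < N then x k else 0) \<subseteq> insert 0 (x ` {..<N})" by auto
  then have "bounded (range (\<lambda>k. if k < N then x k else 0))"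
    by (rule bounded_subset[OF finite_imp_bounded, rotated]) simp
  then have "(\<lambda>k. if k < N then x k else 0) \<in> bcontfun"
    by (simp add: bcontfun_def)
  then show ?thesis unfolding sup_sum_vector_def by (rule Bcontfun_inverse)
qed

lemma norm_sup_sum_vector_le:
  assumes "\<And>k. k < N \<Longrightarrow> norm (x k) \<le> C" and "0 \<le> C"
  shows "norm (sup_sum_vector N x) \<le> C"
  using assms by (intro norm_bound) (simp add: apply_sup_sum_vector)

lemma norm_le_norm_sup_sum_vector:
  assumes "k < N"
  shows "norm (x k) \<le> norm (sup_sum_vector N x)"
  using norm_bounded[of "sup_sum_vector N x" k] assms by (simp add: apply_sup_sum_vector)

lemma sup_sum_vector_add:
  "sup_sum_vector N (\<lambda>k. x k + y k) = sup_sum_vector N x + sup_sum_vector N y"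
  by (rule bcontfun_eqI) (simp add: apply_sup_sum_vector)

lemma sup_sum_vector_scaleR:
  "sup_sum_vector N (\<lambda>k. c *\<^sub>R x k) = c *\<^sub>R sup_sum_vector N x"
  by (rule bcontfun_eqI) (simp add: apply_sup_sum_vector)

lemma almost_norming_vector:
  fixes \<xi> :: "'a::real_normed_vector \<Rightarrow>\<^sub>L real"
  assumes "\<epsilon> > 0"
  shows "\<exists>x. norm x \<le> 1 \<and> norm \<xi> - \<epsilon> \<le> blinfun_apply \<xi> x"
proof (rule ccontr)
  assume "\<not> ?thesis"
  then have less: "\<xi> x < norm \<xi> - \<epsilon>" if "norm x \<le> 1" for x using that by force
  have pos: "norm \<xi> - \<epsilon> > 0" using less[of 0] by simp
  have "norm \<xi> \<le> norm \<xi> - \<epsilon>"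
  proof (rule norm_blinfun_bound)
    fix x
    show "norm (\<xi> x) \<le> (norm \<xi> - \<epsilon>) * norm x"
    proof (cases "x = 0")
      case False
      let ?e = "x /\<^sub>R norm x"
      have "\<xi> ?e < norm \<xi> - \<epsilon>" "\<xi> (- ?e) < norm \<xi> - \<epsilon>"
        using False by (auto intro!: less)
      then have "\<bar>\<xi> ?e\<bar> \<le> norm \<xi> - \<epsilon>" by (simp add: blinfun.minus_right)
      then show ?thesis
        using False by (simp add: blinfun.scaleR_right abs_mult field_simps)
    qed (simp add: blinfun.zero_right)
  qed (use pos in simp)
  with assms show False by simp
qed

text \<open>
  The bound on \<open>\<Sum>k<N. norm (\<xi> k)\<close> is obtained by evaluating \<open>F\<close> at a vector of the unit ball each
  of whose coordinates almost norms the corresponding \<open>\<xi> k\<close>.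
\<close>

lemma functional_on_sup_sum:
  fixes F :: "(nat \<Rightarrow>\<^sub>C 'a::real_normed_vector) \<Rightarrow>\<^sub>L real"
  shows "\<exists>\<xi> :: nat \<Rightarrow> 'a \<Rightarrow>\<^sub>L real. (\<Sum>k<N. norm (\<xi> k)) \<le> norm F
    \<and> (\<forall>x. blinfun_apply F (sup_sum_vector N x) = (\<Sum>k<N. blinfun_apply (\<xi> k) (x k)))"
proof -
  let ?e = "\<lambda>k x. sup_sum_vector N (\<lambda>i. if i = k then x else 0)"
  have bl: "bounded_linear (\<lambda>x. F (?e k x))" for k
  proof (rule bounded_linear_intro)
    show "F (?e k (x + y)) = F (?e k x) + F (?e k y)" for x y
      unfolding blinfun.add_right[symmetric] sup_sum_vector_add[symmetric]
      by (rule arg_cong[of _ _ F], rule arg_cong[of _ _ "sup_sum_vector N"], auto)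
    show "F (?e k (r *\<^sub>R x)) = r *\<^sub>R F (?e k x)" for r x
      unfolding blinfun.scaleR_right[symmetric] sup_sum_vector_scaleR[symmetric]
      by (rule arg_cong[of _ _ F], rule arg_cong[of _ _ "sup_sum_vector N"], auto)
    show "norm (F (?e k x)) \<le> norm x * norm F" for x
    proof -
      have "norm (F (?e k x)) \<le> norm F * norm (?e k x)" by (rule norm_blinfun)
      also have "\<dots> \<le> norm F * norm x"
        by (intro mult_left_mono norm_sup_sum_vector_le) auto
      finally show ?thesis by (simp add: mult.commute)
    qed
  qed
  define \<xi> where "\<xi> k = Blinfun (\<lambda>x. F (?e k x))" for k
  have \<xi>: "\<xi> k x = F (?e k x)" for k x
    unfolding \<xi>_def using bl by (simp add: bounded_linear_Blinfun_apply)
  have rep: "F (sup_sum_vector N x) = (\<Sum>k<N. \<xi> k (x k))" for x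
  proof -
    have app: "apply_bcontfun (\<Sum>k\<in>A. h k) i = (\<Sum>k\<in>A. apply_bcontfun (h k) i)"
      for A :: "nat set" and h :: "nat \<Rightarrow> nat \<Rightarrow>\<^sub>C 'a" and i
      by (induction A rule: infinite_finite_induct) auto
    have "sup_sum_vector N x = (\<Sum>k<N. ?e k (x k))"
      by (rule bcontfun_eqI) (auto simp: app apply_sup_sum_vector)
    then show ?thesis by (simp add: blinfun.sum_right \<xi>)
  qed
  have "(\<Sum>k<N. norm (\<xi> k)) \<le> norm F + \<epsilon>" if "\<epsilon> > 0" for \<epsilon>
  proof -
    let ?\<delta> = "\<epsilon> / (real N + 1)"
    have \<delta>: "?\<delta> > 0" using that by simp
    have "\<forall>k. \<exists>v. norm v \<le> 1 \<and> norm (\<xi> k) - ?\<delta> \<le> blinfun_apply (\<xi> k) v"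
      using almost_norming_vector[OF \<delta>] by blast
    then obtain x where x: "\<And>k. norm (x k) \<le> 1 \<and> norm (\<xi> k) - ?\<delta> \<le> blinfun_apply (\<xi> k) (x k)"
      by metis
    have "(\<Sum>k<N. norm (\<xi> k) - ?\<delta>) \<le> (\<Sum>k<N. \<xi> k (x k))"
      using x by (intro sum_mono) blast
    also have "\<dots> = F (sup_sum_vector N x)" by (rule rep[symmetric])
    also have "\<dots> \<le> norm F * norm (sup_sum_vector N x)"
      using norm_blinfun[of F "sup_sum_vector N x"] by simp
    also have "\<dots> \<le> norm F * 1"
      using x by (intro mult_left_mono norm_sup_sum_vector_le) auto
    finally have "(\<Sum>k<N. norm (\<xi> k)) \<le> norm F + real N * ?\<delta>"
      by (simp add: sum_subtractf)
    moreover have "real N * ?\<delta> \<le> \<epsilon>" using that by (simp add: field_simps)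
    ultimately show ?thesis by linarith
  qed
  then have "(\<Sum>k<N. norm (\<xi> k)) \<le> norm F" by (rule field_le_epsilon)
  with rep show ?thesis by blast
qed

section \<open>The injective norm\<close>

lemma abs_tensor_eval_le:
  "\<bar>tensor_eval f g u\<bar> \<le> norm f * norm g * norm u"
proof (cases "f = 0 \<or> g = 0")
  case True
  then show ?thesis
    using tensor_eval_scale[of 0 f 1 g u] tensor_eval_scale[of 1 f 0 g u] by auto
next
  case False
  have "norm (f /\<^sub>R norm f) = 1" "norm (g /\<^sub>R norm g) = 1" using False by auto
  then have "\<bar>tensor_eval (f /\<^sub>R norm f) (g /\<^sub>R norm g) u\<bar> \<le> norm u"
    unfolding norm_tensor_def using bdd_above_tensor_eval[of u]
    by (intro cSup_upper) (auto simp del: norm_scaleR)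
  with False show ?thesis by (simp add: tensor_eval_scale abs_mult field_simps)
qed

lemma norm_tensor_le:
  assumes "0 \<le> C" and "\<And>f g. norm f = 1 \<Longrightarrow> norm g = 1 \<Longrightarrow> \<bar>tensor_eval f g u\<bar> \<le> C"
  shows "norm u \<le> C"
  unfolding norm_tensor_def using assms by (intro cSup_least) auto

lemma almost_norming_tensor_eval:
  assumes "0 \<le> C" and "C < norm u"
  shows "\<exists>f g. norm f = 1 \<and> norm g = 1 \<and> C < tensor_eval f g u"
proof (rule ccontr)
  assume contra: "\<not> ?thesis"
  have "norm u \<le> C"
  proof (rule norm_tensor_le[OF assms(1)])
    fix f :: "'a \<Rightarrow>\<^sub>L real" and g :: "'b \<Rightarrow>\<^sub>L real"
    assume n: "norm f = 1" "norm g = 1"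
    then have "tensor_eval f g u \<le> C" using contra by force
    moreover have "norm (- f) = 1" using n by simp
    then have "tensor_eval (- f) g u \<le> C" using contra n(2) by (meson not_le)
    ultimately show "\<bar>tensor_eval f g u\<bar> \<le> C"
      using tensor_eval_scale[of "-1" f 1 g u] by simp
  qed
  with assms show False by simp
qed

text \<open>If \<open>f\<close> norms the contraction, the norm is the value of \<open>f \<otimes> g\<close> at the tensor.\<close>

lemma norm_contraction_le:
  fixes x :: "'i \<Rightarrow> 'a::real_normed_vector" and y :: "'i \<Rightarrow> 'b::real_normed_vector"
    and g :: "'b \<Rightarrow>\<^sub>L real"
  shows "norm (\<Sum>i\<in>I. blinfun_apply g (y i) *\<^sub>R x i) \<le> norm g * norm (\<Sum>i\<in>I. tprod (x i) (y i))"
proof (cases "(\<Sum>i\<in>I. blinfun_apply g (y i) *\<^sub>R x i) = 0")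
  case False
  then obtain f :: "'a \<Rightarrow>\<^sub>L real"
    where f: "norm f = 1" "f (\<Sum>i\<in>I. blinfun_apply g (y i) *\<^sub>R x i) = norm (\<Sum>i\<in>I. blinfun_apply g (y i) *\<^sub>R x i)"
    using exists_norming_functional by blast
  have "f (\<Sum>i\<in>I. blinfun_apply g (y i) *\<^sub>R x i) = tensor_eval f g (\<Sum>i\<in>I. tprod (x i) (y i))"
    by (simp add: tensor_eval_sum blinfun.sum_right blinfun.scaleR_right mult.commute)
  then show ?thesis
    using abs_tensor_eval_le[of f g "\<Sum>i\<in>I. tprod (x i) (y i)"] f by simp
qed simp

text \<open>
  Points of \<open>B\<close> act as functionals on the dual space, where they remain independent because
  the dual separates points; so the prescribed values can be attained.
\<close>

lemma biorthogonal_functionals: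
  fixes B :: "'b::real_normed_vector set"
  assumes B: "finite B" "independent B" and "b \<in> B"
  shows "\<exists>h :: 'b \<Rightarrow>\<^sub>L real. \<forall>b'\<in>B. blinfun_apply h b' = (if b' = b then 1 else 0)"
proof (rule functional_equations_solvable[where \<phi> = "\<lambda>b h. blinfun_apply h b", OF B(1)])
  show "linear (\<lambda>h :: 'b \<Rightarrow>\<^sub>L real. blinfun_apply h b')" for b'
    by (rule linearI) (simp_all add: blinfun.add_left blinfun.scaleR_left)
  fix a assume a: "\<And>h :: 'b \<Rightarrow>\<^sub>L real. (\<Sum>b\<in>B. a b * blinfun_apply h b) = 0"
  have "(\<Sum>b\<in>B. a b *\<^sub>R b) = 0"
    by (rule functionals_separate_points) (simp add: blinfun.sum_right blinfun.scaleR_right a)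
  then have "a b' = 0" if "b' \<in> B" for b'
    using independentD[OF B(2) B(1) order_refl] that by blast
  then show "(\<Sum>b'\<in>B. a b' * (if b' = b then 1 else 0)) = 0" by simp
qed

text \<open>
  Sort the functionals of the unit ball into finitely many cells by rounding their values at the
  points of \<open>B\<close> to multiples of \<open>\<eta>\<close>, and pick one functional from each occupied cell.
\<close>

lemma finite_net_of_functionals:
  fixes B :: "'b::real_normed_vector set"
  assumes B: "finite B" and \<eta>: "\<eta> > 0"
  shows "\<exists>\<Gamma> :: ('b \<Rightarrow>\<^sub>L real) set. finite \<Gamma> \<and> (\<forall>\<gamma>\<in>\<Gamma>. norm \<gamma> \<le> 1)
    \<and> (\<forall>g. norm g \<le> 1 \<longrightarrow> (\<exists>\<gamma>\<in>\<Gamma>. \<forall>b\<in>B. \<bar>blinfun_apply g b - blinfun_apply \<gamma> b\<bar> \<le> \<eta>))"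
proof -
  define cell :: "('b \<Rightarrow>\<^sub>L real) \<Rightarrow> 'b \<Rightarrow> int" where
    "cell g = restrict (\<lambda>b. \<lfloor>g b / \<eta>\<rfloor>) B" for g
  let ?U = "cball 0 1 :: ('b \<Rightarrow>\<^sub>L real) set"
  have "cell ` ?U \<subseteq> (\<Pi>\<^sub>E b\<in>B. {\<lfloor>- (norm b / \<eta>)\<rfloor>..\<lfloor>norm b / \<eta>\<rfloor>})"
  proof (rule image_subsetI)
    fix g :: "'b \<Rightarrow>\<^sub>L real" assume "g \<in> ?U"
    have "\<bar>g b\<bar> \<le> norm b" for b
      using norm_blinfun[of g b] mult_right_mono[of "norm g" 1 "norm b"] \<open>g \<in> ?U\<close> by simp
    then have "- norm b \<le> g b" "g b \<le> norm b" for b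
      by (simp_all add: abs_le_iff minus_le_iff)
    then have "- (norm b / \<eta>) \<le> g b / \<eta>" "g b / \<eta> \<le> norm b / \<eta>" for b
      using \<eta> divide_right_mono[of "- norm b" "g b" \<eta>] by (simp_all add: divide_right_mono)
    then show "cell g \<in> (\<Pi>\<^sub>E b\<in>B. {\<lfloor>- (norm b / \<eta>)\<rfloor>..\<lfloor>norm b / \<eta>\<rfloor>})"
      by (auto simp: cell_def intro!: floor_mono)
  qed
  then have fin: "finite (cell ` ?U)"
    by (rule finite_subset) (intro finite_PiE B, simp)
  define r where "r c = (SOME \<gamma>. \<gamma> \<in> ?U \<and> cell \<gamma> = c)" for c
  have r: "r (cell g) \<in> ?U \<and> cell (r (cell g)) = cell g" if "g \<in> ?U" for g
    unfolding r_def by (rule someI[of _ g]) (use that in simp)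
  show ?thesis
  proof (intro exI[of _ "r ` cell ` ?U"] conjI)
    show "finite (r ` cell ` ?U)" using fin by blast
    show "\<forall>\<gamma>\<in>r ` cell ` ?U. norm \<gamma> \<le> 1" using r by auto
    show "\<forall>g. norm g \<le> 1 \<longrightarrow> (\<exists>\<gamma>\<in>r ` cell ` ?U. \<forall>b\<in>B. \<bar>blinfun_apply g b - blinfun_apply \<gamma> b\<bar> \<le> \<eta>)"
    proof (intro allI impI)
      fix g :: "'b \<Rightarrow>\<^sub>L real" assume "norm g \<le> 1"
      then have g: "g \<in> ?U" by simp
      have "\<bar>g b - r (cell g) b\<bar> \<le> \<eta>" if "b \<in> B" for b
      proof -
        have "cell (r (cell g)) b = cell g b" using r[OF g] by simp
        then have "\<lfloor>r (cell g) b / \<eta>\<rfloor> = \<lfloor>g b / \<eta>\<rfloor>" using that by (simp add: cell_def)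
        then have "\<bar>g b / \<eta> - r (cell g) b / \<eta>\<bar> \<le> 1" by linarith
        then have "\<bar>(g b - r (cell g) b) / \<eta>\<bar> \<le> 1" by (simp add: diff_divide_distrib)
        then show ?thesis using \<eta> by (simp add: abs_divide)
      qed
      with g show "\<exists>\<gamma>\<in>r ` cell ` ?U. \<forall>b\<in>B. \<bar>blinfun_apply g b - blinfun_apply \<gamma> b\<bar> \<le> \<eta>" by blast
    qed
  qed
qed

text \<open>
  The family consists of a fine net of functionals together with the normalised biorthogonal
  functionals of \<open>B\<close>. The latter control the single coefficients \<open>x b\<close> by \<open>D\<close>, which makes the error
  of replacing an arbitrary functional by an element of the net proportional to \<open>D\<close>.
\<close>

lemma finite_norming_family:
  fixes B :: "'b::real_normed_vector set"
  assumes B: "finite B" "independent B" and \<eta>: "\<eta> > 0"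
  shows "\<exists>N (g :: nat \<Rightarrow> 'b \<Rightarrow>\<^sub>L real). (\<forall>k<N. norm (g k) \<le> 1) \<and>
    (\<forall>(x :: 'b \<Rightarrow> 'a::real_normed_vector) D. 0 \<le> D \<longrightarrow>
      (\<forall>k<N. norm (\<Sum>b\<in>B. blinfun_apply (g k) b *\<^sub>R x b) \<le> D) \<longrightarrow>
      norm (\<Sum>b\<in>B. tprod (x b) b) \<le> (1 + \<eta>) * D)"
proof -
  have "\<forall>b\<in>B. \<exists>h :: 'b \<Rightarrow>\<^sub>L real. \<forall>b'\<in>B. blinfun_apply h b' = (if b' = b then 1 else 0)"
    using biorthogonal_functionals[OF B] by blast
  then obtain h :: "'b \<Rightarrow> 'b \<Rightarrow>\<^sub>L real"
    where h: "\<And>b b'. b \<in> B \<Longrightarrow> b' \<in> B \<Longrightarrow> h b b' = (if b' = b then 1 else 0)"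
    by (metis (no_types))
  have h0: "norm (h b) > 0" if "b \<in> B" for b
    using h[OF that that] by auto
  define H where "H = (\<Sum>b\<in>B. norm (h b))"
  have H: "0 \<le> H" unfolding H_def by (intro sum_nonneg) simp
  have \<eta>': "\<eta> / (1 + H) > 0" using \<eta> H by simp
  obtain \<Gamma> :: "('b \<Rightarrow>\<^sub>L real) set" where \<Gamma>: "finite \<Gamma>" "\<And>\<gamma>. \<gamma> \<in> \<Gamma> \<Longrightarrow> norm \<gamma> \<le> 1"
    "\<And>g :: 'b \<Rightarrow>\<^sub>L real. norm g \<le> 1 \<Longrightarrow> \<exists>\<gamma>\<in>\<Gamma>. \<forall>b\<in>B. \<bar>blinfun_apply g b - blinfun_apply \<gamma> b\<bar> \<le> \<eta> / (1 + H)"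
    using finite_net_of_functionals[OF B(1) \<eta>'] by blast
  let ?\<Gamma> = "\<Gamma> \<union> (\<lambda>b. h b /\<^sub>R norm (h b)) ` B"
  have "finite ?\<Gamma>" using \<Gamma>(1) B(1) by simp
  then obtain N and g :: "nat \<Rightarrow> 'b \<Rightarrow>\<^sub>L real" where g: "?\<Gamma> = g ` {i. i < N}"
    unfolding finite_conv_nat_seg_image by (elim exE)
  have "norm \<gamma> \<le> 1" if "\<gamma> \<in> ?\<Gamma>" for \<gamma>
    using that \<Gamma>(2) h0 by auto
  then have "\<forall>k<N. norm (g k) \<le> 1" unfolding g by simp
  moreover have "norm (\<Sum>b\<in>B. tprod (x b) b) \<le> (1 + \<eta>) * D"
    if D: "0 \<le> D" and le: "\<forall>k<N. norm (\<Sum>b\<in>B. blinfun_apply (g k) b *\<^sub>R x b) \<le> D"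
    for x :: "'b \<Rightarrow> 'a" and D
  proof -
    have le': "norm (\<Sum>b\<in>B. \<gamma> b *\<^sub>R x b) \<le> D" if "\<gamma> \<in> ?\<Gamma>" for \<gamma> :: "'b \<Rightarrow>\<^sub>L real"
      using that le unfolding g by auto
    have xb: "norm (x b) \<le> norm (h b) * D" if b: "b \<in> B" for b
    proof -
      have "(\<Sum>b'\<in>B. (h b /\<^sub>R norm (h b)) b' *\<^sub>R x b')
          = (\<Sum>b'\<in>B. if b' = b then x b /\<^sub>R norm (h b) else 0)"
        using h[OF b] by (intro sum.cong) (auto simp: blinfun.scaleR_left)
      also have "\<dots> = x b /\<^sub>R norm (h b)" using B(1) b by simp
      finally have "norm (x b /\<^sub>R norm (h b)) \<le> D"
        using le'[of "h b /\<^sub>R norm (h b)"] b by auto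
      then show ?thesis using h0[OF b] by (simp add: field_simps)
    qed
    show ?thesis
    proof (rule norm_tensor_le)
      show "0 \<le> (1 + \<eta>) * D" using D \<eta> by simp
      fix f :: "'a \<Rightarrow>\<^sub>L real" and g' :: "'b \<Rightarrow>\<^sub>L real"
      assume f: "norm f = 1" and g': "norm g' = 1"
      then obtain \<gamma> where \<gamma>: "\<gamma> \<in> \<Gamma>" "\<And>b. b \<in> B \<Longrightarrow> \<bar>blinfun_apply g' b - blinfun_apply \<gamma> b\<bar> \<le> \<eta> / (1 + H)"
        using \<Gamma>(3)[of g'] by auto
      have f_le: "\<bar>f v\<bar> \<le> norm v" for v using norm_blinfun[of f v] f by simp
      have "tensor_eval f g' (\<Sum>b\<in>B. tprod (x b) b)
          = f (\<Sum>b\<in>B. \<gamma> b *\<^sub>R x b) + (\<Sum>b\<in>B. f (x b) * (g' b - \<gamma> b))"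
        by (simp add: tensor_eval_sum blinfun.sum_right blinfun.scaleR_right
            sum.distrib[symmetric] algebra_simps)
      also have "\<bar>\<dots>\<bar> \<le> \<bar>f (\<Sum>b\<in>B. \<gamma> b *\<^sub>R x b)\<bar> + \<bar>\<Sum>b\<in>B. f (x b) * (g' b - \<gamma> b)\<bar>"
        by (rule abs_triangle_ineq)
      also have "\<dots> \<le> D + (\<Sum>b\<in>B. norm (h b) * D * (\<eta> / (1 + H)))"
      proof (rule add_mono)
        show "\<bar>f (\<Sum>b\<in>B. \<gamma> b *\<^sub>R x b)\<bar> \<le> D"
          using f_le[of "\<Sum>b\<in>B. \<gamma> b *\<^sub>R x b"] le'[of \<gamma>] \<gamma>(1) by simp
        show "\<bar>\<Sum>b\<in>B. f (x b) * (g' b - \<gamma> b)\<bar> \<le> (\<Sum>b\<in>B. norm (h b) * D * (\<eta> / (1 + H)))"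
        proof (rule order_trans[OF sum_abs], rule sum_mono)
          fix b assume b: "b \<in> B"
          show "\<bar>f (x b) * (g' b - \<gamma> b)\<bar> \<le> norm (h b) * D * (\<eta> / (1 + H))"
            unfolding abs_mult using f_le[of "x b"] xb[OF b] \<gamma>(2)[OF b] D
            by (intro mult_mono) auto
        qed
      qed
      also have "(\<Sum>b\<in>B. norm (h b) * D * (\<eta> / (1 + H))) = (H / (1 + H)) * (\<eta> * D)"
        by (simp only: sum_distrib_right[symmetric] H_def[symmetric]) simp
      also have "\<dots> \<le> 1 * (\<eta> * D)"
        using H \<eta> D by (intro mult_right_mono) (auto simp: field_simps)
      finally show "\<bar>tensor_eval f g' (\<Sum>b\<in>B. tprod (x b) b)\<bar> \<le> (1 + \<eta>) * D"
        by (simp add: algebra_simps)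
    qed
  qed
  ultimately show ?thesis by blast
qed

lemma norm_tprod_le: "norm (tprod x y) \<le> norm x * norm y"
proof (rule norm_tensor_le)
  fix f :: "'a \<Rightarrow>\<^sub>L real" and g :: "'b \<Rightarrow>\<^sub>L real"
  assume "norm f = 1" "norm g = 1"
  then show "\<bar>tensor_eval f g (tprod x y)\<bar> \<le> norm x * norm y"
    using norm_blinfun[of f x] norm_blinfun[of g y] by (auto simp: abs_mult intro: mult_mono)
qed simp

definition partial_functional ::
    "('a::real_normed_vector, 'b::real_normed_vector) tensor \<Rightarrow>\<^sub>L real \<Rightarrow> 'b \<Rightarrow> 'a \<Rightarrow>\<^sub>L real" where
  "partial_functional \<psi> y = Blinfun (\<lambda>x. \<psi> (tprod x y))"

lemma partial_functional_apply [simp]: "partial_functional \<psi> y x = \<psi> (tprod x y)"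
proof -
  have "bounded_linear (\<lambda>x. \<psi> (tprod x y))"
  proof (rule bounded_linear_intro)
    show "norm (\<psi> (tprod x y)) \<le> norm x * (norm \<psi> * norm y)" for x
      using norm_blinfun[of \<psi> "tprod x y"]
        mult_left_mono[OF norm_tprod_le[of x y], of "norm \<psi>"] by (simp add: mult_ac)
  qed (simp_all add: tprod_add_left tprod_scaleR_left blinfun.add_right blinfun.scaleR_right)
  then show ?thesis by (simp add: partial_functional_def bounded_linear_Blinfun_apply)
qed

text \<open>
  The right-hand side of the equation for \<open>\<psi>\<close> is the value of \<open>\<psi>\<close>, extended to \<open>X** \<otimes> Y\<close>, at
  \<open>\<Sum>b\<in>B. T* (x b) \<otimes> b\<close>. So the statement is a form of the principle of local reflexivity, and like
  that principle it rests on Helly's theorem. The unknown is the coefficient family of \<open>w\<close> with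
  respect to \<open>B\<close>, and it is measured in the finite \<open>\<ell>\<^sub>\<infinity>\<close>-sum given by a norming family \<open>g\<close>.
  A functional on that sum is given by \<open>\<xi> k \<in> X*\<close>; if it restricts to a combination of the
  \<open>\<psi>\<close>, then the same combination of the right-hand sides is the sum of the
  \<open>(T (\<xi> k)) (\<Sum>b\<in>B. g k b x b)\<close>, hence at most \<open>\<parallel>T\<parallel> \<parallel>u\<parallel> \<Sum>k. \<parallel>\<xi> k\<parallel>\<close>, where \<open>u\<close> is
  \<open>\<Sum>b\<in>B. x b \<otimes> b\<close>.
\<close>

theorem tensor_moved_by_dual_operator:
  fixes T :: "('a::real_normed_vector \<Rightarrow>\<^sub>L real) \<Rightarrow>\<^sub>L ('a \<Rightarrow>\<^sub>L real)"
    and x :: "'b::real_normed_vector \<Rightarrow> 'a" and \<Phi> :: "(('a, 'b) tensor \<Rightarrow>\<^sub>L real) set"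
  assumes B: "finite B" "independent B" and \<Phi>: "finite \<Phi>"
    and M': "norm T * norm (\<Sum>b\<in>B. tprod (x b) b) < M'"
  shows "\<exists>w. norm w \<le> M' \<and> (\<forall>\<psi>\<in>\<Phi>. blinfun_apply \<psi> w
    = (\<Sum>b\<in>B. blinfun_apply (blinfun_apply T (partial_functional \<psi> b)) (x b)))"
proof -
  define M where "M = norm T * norm (\<Sum>b\<in>B. tprod (x b) b)"
  have M: "0 \<le> M" "M < M'" using M' by (simp_all add: M_def)
  \<comment> \<open>The gap between \<open>M\<close> and \<open>M'\<close> is shared: Helly's theorem uses it up to \<open>M1\<close>, the passage from
    the norming family to the injective norm costs the remaining factor \<open>M' / M1\<close>.\<close>
  define M1 where "M1 = (M + M') / 2"
  have M1: "0 < M1" "M < M1" "M1 < M'" using M by (simp_all add: M1_def)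
  have \<eta>: "M' / M1 - 1 > 0" using M1 by simp
  obtain N and g :: "nat \<Rightarrow> 'b \<Rightarrow>\<^sub>L real" where gN: "(\<forall>k<N. norm (g k) \<le> 1) \<and>
    (\<forall>(x :: 'b \<Rightarrow> 'a) D. 0 \<le> D \<longrightarrow>
      (\<forall>k<N. norm (\<Sum>b\<in>B. blinfun_apply (g k) b *\<^sub>R x b) \<le> D) \<longrightarrow>
      norm (\<Sum>b\<in>B. tprod (x b) b) \<le> (1 + (M' / M1 - 1)) * D)"
    using finite_norming_family[OF B \<eta>, where ?'a = 'a] by (elim exE)
  have g: "norm (g k) \<le> 1" if "k < N" for k using gN that by blast
  have norming: "norm (\<Sum>b\<in>B. tprod (x b) b) \<le> (1 + (M' / M1 - 1)) * D"
    if "0 \<le> D" "\<And>k. k < N \<Longrightarrow> norm (\<Sum>b\<in>B. blinfun_apply (g k) b *\<^sub>R x b) \<le> D"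
    for x :: "'b \<Rightarrow> 'a" and D
    using conjunct2[OF gN] that by simp
  define \<tau> :: "('b \<Rightarrow>\<^sub>0 'a) \<Rightarrow> ('a, 'b) tensor"
    where "\<tau> w = (\<Sum>b\<in>B. tprod (Poly_Mapping.lookup w b) b)" for w
  define \<iota> :: "('b \<Rightarrow>\<^sub>0 'a) \<Rightarrow> nat \<Rightarrow>\<^sub>C 'a"
    where "\<iota> w = sup_sum_vector N (\<lambda>k. \<Sum>b\<in>B. g k b *\<^sub>R Poly_Mapping.lookup w b)" for w
  have lin_\<tau>: "linear \<tau>"
    by (rule linearI) (simp_all add: \<tau>_def lookup_add scaleR_poly_mapping.rep_eq tprod_add_left
        tprod_scaleR_left sum.distrib scaleR_sum_right)
  have lin_\<iota>: "linear \<iota>"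
    unfolding \<iota>_def
    by (rule linearI) (simp_all add: lookup_add scaleR_poly_mapping.rep_eq scaleR_add_right
        sum.distrib sup_sum_vector_add sup_sum_vector_scaleR[symmetric] scaleR_sum_right mult.commute)
  let ?c = "\<lambda>\<psi>. \<Sum>b\<in>B. T (partial_functional \<psi> b) (x b)"
  have "\<exists>w. (\<forall>\<psi>\<in>\<Phi>. blinfun_apply \<psi> (\<tau> w) = ?c \<psi>) \<and> norm (\<iota> w) < M1"
  proof (rule Helly_linear_image[OF \<Phi> _ lin_\<iota> _ M(1) M1(2)])
    show "linear (\<lambda>w. blinfun_apply \<psi> (\<tau> w))" for \<psi>
      using linear_compose[OF lin_\<tau> bounded_linear.linear[OF blinfun.bounded_linear_right[of \<psi>]]]
      by (simp add: o_def)
    fix F :: "(nat \<Rightarrow>\<^sub>C 'a) \<Rightarrow>\<^sub>L real" and a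
    assume F: "\<And>w. blinfun_apply F (\<iota> w) = (\<Sum>\<psi>\<in>\<Phi>. a \<psi> * blinfun_apply \<psi> (\<tau> w))"
    obtain \<xi> :: "nat \<Rightarrow> 'a \<Rightarrow>\<^sub>L real" where \<xi>: "(\<Sum>k<N. norm (\<xi> k)) \<le> norm F"
      "\<And>x. F (sup_sum_vector N x) = (\<Sum>k<N. blinfun_apply (\<xi> k) (x k))"
      using functional_on_sup_sum[of N F] by blast
    \<comment> \<open>Comparing \<open>F \<circ> \<iota>\<close> with the combination at elementary tensors \<open>v \<otimes> b\<close>.\<close>
    have decomp: "(\<Sum>\<psi>\<in>\<Phi>. a \<psi> *\<^sub>R partial_functional \<psi> b) = (\<Sum>k<N. g k b *\<^sub>R \<xi> k)"
      if b: "b \<in> B" for b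
    proof (rule blinfun_eqI)
      fix v :: 'a
      let ?w = "Poly_Mapping.single b v :: 'b \<Rightarrow>\<^sub>0 'a"
      have "(\<Sum>b'\<in>B. g k b' *\<^sub>R Poly_Mapping.lookup ?w b')
          = (\<Sum>b'\<in>B. if b' = b then g k b *\<^sub>R v else 0)" for k
        by (intro sum.cong) (auto simp: lookup_single)
      then have "F (\<iota> ?w) = (\<Sum>k<N. \<xi> k (g k b *\<^sub>R v))"
        using B(1) b by (simp add: \<iota>_def \<xi>(2))
      moreover have "\<tau> ?w = (\<Sum>b'\<in>B. if b' = b then tprod v b else 0)"
        unfolding \<tau>_def
        by (intro sum.cong) (auto simp: lookup_single linear_0[OF linear_tprod_left])
      then have "\<tau> ?w = tprod v b" using B(1) b by simp
      ultimately show "(\<Sum>\<psi>\<in>\<Phi>. a \<psi> *\<^sub>R partial_functional \<psi> b) v = (\<Sum>k<N. g k b *\<^sub>R \<xi> k) v"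
        using F[of ?w]
        by (simp add: blinfun.sum_left blinfun.scaleR_left blinfun.scaleR_right)
    qed
    have "(\<Sum>\<psi>\<in>\<Phi>. a \<psi> * ?c \<psi>) = (\<Sum>b\<in>B. \<Sum>\<psi>\<in>\<Phi>. a \<psi> * T (partial_functional \<psi> b) (x b))"
      unfolding sum_distrib_left by (rule sum.swap)
    also have "\<dots> = (\<Sum>b\<in>B. T (\<Sum>\<psi>\<in>\<Phi>. a \<psi> *\<^sub>R partial_functional \<psi> b) (x b))"
      by (simp add: blinfun.sum_right blinfun.scaleR_right blinfun.sum_left blinfun.scaleR_left)
    also have "\<dots> = (\<Sum>b\<in>B. T (\<Sum>k<N. g k b *\<^sub>R \<xi> k) (x b))"
      by (intro sum.cong) (simp_all add: decomp)
    also have "\<dots> = (\<Sum>b\<in>B. \<Sum>k<N. T (\<xi> k) (g k b *\<^sub>R x b))"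
      by (simp add: blinfun.sum_right blinfun.scaleR_right blinfun.sum_left blinfun.scaleR_left)
    also have "\<dots> = (\<Sum>k<N. T (\<xi> k) (\<Sum>b\<in>B. g k b *\<^sub>R x b))"
      by (subst sum.swap) (simp add: blinfun.sum_right)
    also have "\<dots> \<le> (\<Sum>k<N. M * norm (\<xi> k))"
    proof (rule sum_mono)
      fix k assume "k \<in> {..<N}"
      then have gk: "norm (g k) \<le> 1" using g by simp
      have "norm (\<Sum>b\<in>B. g k b *\<^sub>R x b) \<le> norm (g k) * norm (\<Sum>b\<in>B. tprod (x b) b)"
        by (rule norm_contraction_le)
      also have "\<dots> \<le> norm (\<Sum>b\<in>B. tprod (x b) b)"
        using gk by (simp add: mult_left_le_one_le)
      finally have p: "norm (\<Sum>b\<in>B. g k b *\<^sub>R x b) \<le> norm (\<Sum>b\<in>B. tprod (x b) b)" .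
      have "T (\<xi> k) (\<Sum>b\<in>B. g k b *\<^sub>R x b) \<le> norm (T (\<xi> k)) * norm (\<Sum>b\<in>B. g k b *\<^sub>R x b)"
        using norm_blinfun[of "T (\<xi> k)" "\<Sum>b\<in>B. g k b *\<^sub>R x b"] by simp
      also have "\<dots> \<le> (norm T * norm (\<xi> k)) * norm (\<Sum>b\<in>B. tprod (x b) b)"
        using p by (intro mult_mono norm_blinfun) auto
      finally show "T (\<xi> k) (\<Sum>b\<in>B. g k b *\<^sub>R x b) \<le> M * norm (\<xi> k)"
        by (simp add: M_def mult_ac)
    qed
    also have "\<dots> \<le> M * norm F"
      using \<xi>(1) M(1) by (simp add: sum_distrib_left[symmetric] mult_left_mono)
    finally show "(\<Sum>\<psi>\<in>\<Phi>. a \<psi> * ?c \<psi>) \<le> M * norm F" .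
  qed
  then obtain w where w: "\<And>\<psi>. \<psi> \<in> \<Phi> \<Longrightarrow> blinfun_apply \<psi> (\<tau> w) = ?c \<psi>" "norm (\<iota> w) < M1"
    by blast
  have "norm (\<tau> w) \<le> (1 + (M' / M1 - 1)) * M1"
    unfolding \<tau>_def
  proof (rule norming)
    fix k assume "k < N"
    then have "norm (\<Sum>b\<in>B. g k b *\<^sub>R Poly_Mapping.lookup w b) \<le> norm (\<iota> w)"
      unfolding \<iota>_def by (rule norm_le_norm_sup_sum_vector)
    with w(2) show "norm (\<Sum>b\<in>B. g k b *\<^sub>R Poly_Mapping.lookup w b) \<le> M1" by simp
  qed (use M1 in simp)
  with M1 w(1) show ?thesis by (intro exI[of _ "\<tau> w"]) auto
qed

section \<open>Weak neighbourhoods and the weak operator Daugavet property\<close>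

lemma weakly_open_contains_basic_nhd:
  fixes U :: "'z::real_normed_vector set"
  assumes "openin weak_topology U" and "z \<in> U"
  shows "\<exists>(\<Phi> :: ('z \<Rightarrow>\<^sub>L real) set) \<delta>. finite \<Phi> \<and> \<delta> > 0 \<and>
    (\<forall>v. (\<forall>\<phi>\<in>\<Phi>. \<bar>blinfun_apply \<phi> v - blinfun_apply \<phi> z\<bar> < \<delta>) \<longrightarrow> v \<in> U)"
proof -
  have "generate_topology_on {blinfun_apply f -` U | (f :: 'z \<Rightarrow>\<^sub>L real) U. open U} U"
    using assms(1) unfolding weak_topology_def openin_topology_generated_by_iff .
  then show ?thesis using assms(2)
  proof induction
    case Empty
    then show ?case by simp
  next
    case (Int U V)
    then have "z \<in> U" "z \<in> V" by simp_all
    obtain \<Phi> :: "('z \<Rightarrow>\<^sub>L real) set" and \<delta> where U: "finite \<Phi> \<and> \<delta> > 0 \<and>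
      (\<forall>v. (\<forall>\<phi>\<in>\<Phi>. \<bar>blinfun_apply \<phi> v - blinfun_apply \<phi> z\<bar> < \<delta>) \<longrightarrow> v \<in> U)"
      using Int.IH(1)[OF \<open>z \<in> U\<close>] by (elim exE)
    obtain \<Psi> :: "('z \<Rightarrow>\<^sub>L real) set" and \<epsilon> where V: "finite \<Psi> \<and> \<epsilon> > 0 \<and>
      (\<forall>v. (\<forall>\<phi>\<in>\<Psi>. \<bar>blinfun_apply \<phi> v - blinfun_apply \<phi> z\<bar> < \<epsilon>) \<longrightarrow> v \<in> V)"
      using Int.IH(2)[OF \<open>z \<in> V\<close>] by (elim exE)
    from U V show ?case
      by (intro exI[of _ "\<Phi> \<union> \<Psi>"] exI[of _ "min \<delta> \<epsilon>"]) simp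
  next
    case (UN K)
    then obtain U where "U \<in> K" "z \<in> U" by blast
    with UN.IH[of U] show ?case by (meson UnionI)
  next
    case (Basis s)
    then obtain f :: "'z \<Rightarrow>\<^sub>L real" and V where s: "s = blinfun_apply f -` V" "open V" by blast
    with Basis.prems obtain \<delta> where "\<delta> > 0" "ball (f z) \<delta> \<subseteq> V"
      unfolding open_contains_ball by auto
    then show ?case
      by (intro exI[of _ "{f}"] exI[of _ \<delta>]) (auto simp: s dist_real_def abs_minus_commute)
  qed
qed

text \<open>
  The defining property asks for unit vectors. A tolerance divided by a bound for the norms in
  \<open>A\<close> takes care of other vectors; the auxiliary \<open>e\<close> only ensures that at least one vector is tested.
\<close>

lemma WODP_finite_set:
  fixes A :: "'z::banach set"
  assumes wodp: "WODP TYPE('z)" and ne: "\<exists>e::'z. e \<noteq> 0" and A: "finite A"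
    and S: "S \<in> slices" and z': "norm z' \<le> 1" and \<epsilon>: "\<epsilon> > 0"
  shows "\<exists>z\<in>S. \<exists>T :: 'z \<Rightarrow>\<^sub>L 'z. norm T \<le> 1 + \<epsilon> \<and>
    (\<forall>v\<in>A. norm (blinfun_apply T v - v) \<le> \<epsilon>) \<and> norm (blinfun_apply T z - z') < \<epsilon>"
proof -
  obtain e :: 'z where e: "e \<noteq> 0" using ne by blast
  define A' where "A' = sgn ` (insert e (A - {0}))"
  have "finite A'" unfolding A'_def using A by simp
  then obtain x where x: "bij_betw x {1..card A'} A'"
    using ex_bij_betw_nat_finite_1 by blast
  have n: "card A' \<ge> 1" using \<open>finite A'\<close> by (simp add: A'_def Suc_le_eq card_gt_0_iff)
  define C where "C = 1 + (\<Sum>v\<in>A. norm v)"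
  have C: "C \<ge> 1" unfolding C_def by (simp add: sum_nonneg)
  have vC: "norm v \<le> C" if "v \<in> A" for v
    using member_le_sum[of v A norm] that A by (simp add: C_def)
  have "A' \<subseteq> sphere 0 1" using e by (auto simp: A'_def norm_sgn split: if_splits)
  then have sph: "\<forall>i\<in>{1..card A'}. x i \<in> sphere 0 1"
    using bij_betwE[OF x] by blast
  have \<epsilon>C: "\<epsilon> / C > 0" using \<epsilon> C by simp
  have "z' \<in> cball 0 1" using z' by simp
  from wodp[unfolded WODP_def, THEN spec, THEN mp, OF n, THEN spec, THEN spec, THEN bspec, OF S,
      THEN bspec, OF this, THEN mp, OF sph, THEN mp, OF \<epsilon>C]
  obtain z T where z: "z \<in> S" and T: "norm (T :: 'z \<Rightarrow>\<^sub>L 'z) \<le> 1 + \<epsilon> / C"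
      "\<And>i. i \<in> {1..card A'} \<Longrightarrow> norm (T (x i) - x i) < \<epsilon> / C" "norm (T z - z') < \<epsilon> / C"
    by blast
  have le: "\<epsilon> / C \<le> \<epsilon>" using C \<epsilon> by (simp add: field_simps)
  have "norm (T v - v) \<le> \<epsilon>" if v: "v \<in> A" for v
  proof (cases "v = 0")
    case False
    then have "sgn v \<in> A'" using v by (simp add: A'_def)
    then obtain i where "i \<in> {1..card A'}" "x i = sgn v"
      using x by (metis bij_betw_iff_bijections)
    then have "norm (T (sgn v) - sgn v) \<le> \<epsilon> / C" using T(2) by force
    then have "norm v * norm (T (sgn v) - sgn v) \<le> C * (\<epsilon> / C)"
      using vC[OF v] C by (intro mult_mono) auto
    moreover have "norm v * norm (T (sgn v) - sgn v) = norm (norm v *\<^sub>R (T (sgn v) - sgn v))"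
      by simp
    moreover have "norm v *\<^sub>R (T (sgn v) - sgn v) = T v - v"
      using False by (simp add: sgn_div_norm scaleR_diff_right blinfun.scaleR_right)
    ultimately show ?thesis using C by simp
  qed (use \<epsilon> in \<open>simp add: blinfun.zero_right\<close>)
  with z T le show ?thesis by (intro bexI[OF _ z] exI[of _ T]) auto
qed

section \<open>The diametral diameter two property\<close>

theorem theorem3p2:
  assumes "\<exists>x :: 'a::banach. x \<noteq> 0"
    and "\<exists>y :: 'b::banach. y \<noteq> 0"
    and "WODP TYPE('a \<Rightarrow>\<^sub>L real)"
  shows "DD2P TYPE(('a, 'b) injective_tensor)"
  unfolding DD2P_def
proof (intro allI impI ballI)
  fix W :: "('a, 'b) injective_tensor set" and z and \<epsilon> :: real
  assume W: "openin (subtopology weak_topology (cball 0 1)) W"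
    and z: "z \<in> W \<inter> sphere 0 1" and \<epsilon>: "0 < \<epsilon>"
  obtain U where U: "openin weak_topology U" "W = U \<inter> cball 0 1"
    using W unfolding openin_subtopology by blast
  have "z \<in> U" and norm_z: "norm z = 1" using z U by simp_all
  obtain \<Phi> :: "(('a, 'b) injective_tensor \<Rightarrow>\<^sub>L real) set" and \<delta>
    where \<Phi>: "finite \<Phi> \<and> \<delta> > 0 \<and>
      (\<forall>v. (\<forall>\<phi>\<in>\<Phi>. \<bar>blinfun_apply \<phi> v - blinfun_apply \<phi> z\<bar> < \<delta>) \<longrightarrow> v \<in> U)"
    using weakly_open_contains_basic_nhd[OF U(1) \<open>z \<in> U\<close>] by (elim exE)
  define K where "K = (\<Sum>\<phi>\<in>\<Phi>. norm \<phi>)"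
  have K: "0 \<le> K" unfolding K_def by (simp add: sum_nonneg)
  have norm_\<phi>: "norm \<phi> \<le> K" if "\<phi> \<in> \<Phi>" for \<phi>
    using member_le_sum[of \<phi> \<Phi> norm] that \<Phi> by (simp add: K_def)
  \<comment> \<open>All errors below are multiples of the single parameter \<open>t\<close>: the functionals in \<open>\<Phi>\<close> move by
    less than \<open>(8 K + 2) t\<close>, and the final distance is more than \<open>2 - 14 t\<close>.\<close>
  define t where "t = min (1/2) (min (\<epsilon> / 15) (\<delta> / (8 * K + 2)))"
  have t: "0 < t" using \<epsilon> \<Phi> K by (auto simp: t_def)
  have t_le: "t \<le> 1/2" "t \<le> \<epsilon> / 15" "t \<le> \<delta> / (8 * K + 2)"
    unfolding t_def by linarith+
  have t\<delta>: "(8 * K + 2) * t \<le> \<delta>" using t_le(3) K by (simp add: field_simps)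

  obtain u :: "('a, 'b) tensor" where u: "norm (to_completion u - z) < t"
    using dense_to_completion[where ?'a = "('a, 'b) tensor"]
      closure_approachable[of z "range to_completion"] t by (auto simp: dist_norm)
  have norm_u: "1 - t < norm u" "norm u < 1 + t"
    using norm_triangle_ineq3[of "to_completion u" z] u norm_z by auto
  obtain B :: "'b set" and x where B: "finite B" "independent B"
    and u_eq: "u = (\<Sum>b\<in>B. tprod (x b) b)"
    using tensor_independent_form[of u] by blast
  obtain f :: "'a \<Rightarrow>\<^sub>L real" and g :: "'b \<Rightarrow>\<^sub>L real"
    where f: "norm f = 1" and g: "norm g = 1" and fg: "1 - 2 * t < tensor_eval f g u"
    using almost_norming_tensor_eval[of "1 - 2 * t" u] t t_le norm_u by auto
  define x0 where "x0 = (\<Sum>b\<in>B. g b *\<^sub>R x b)"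
  have eval_x0: "tensor_eval h g u = h x0" for h
    by (simp add: u_eq x0_def tensor_eval_sum blinfun.sum_right blinfun.scaleR_right mult.commute)
  have norm_x0: "norm x0 \<le> 2"
    using norm_contraction_le[of g "\<lambda>b. b" x B] g norm_u t_le by (simp add: x0_def u_eq)

  define ev :: "('a \<Rightarrow>\<^sub>L real) \<Rightarrow>\<^sub>L real" where "ev = Blinfun (\<lambda>h. blinfun_apply h x0)"
  have ev: "blinfun_apply ev h = h x0" for h
    unfolding ev_def by (simp add: bounded_linear_Blinfun_apply blinfun.bounded_linear_left)
  define S where "S = {h \<in> cball 0 1. ev h > (SUP h\<in>cball 0 1. ev h) - t}"
  have S: "S \<in> slices" unfolding S_def slices_def using t by blast
  \<comment> \<open>The tolerance for the WODP is chosen after the representation of \<open>u\<close>, since the error it causes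
    is multiplied by \<open>\<Sum>b\<in>B. norm (x b)\<close> in \<open>near\<close> and by \<open>norm x0 \<le> 2\<close> in \<open>Th_x0\<close>.\<close>
  define e where "e = t / (2 + (\<Sum>b\<in>B. norm (x b)))"
  have X: "0 \<le> (\<Sum>b\<in>B. norm (x b))" by (simp add: sum_nonneg)
  have e: "0 < e" "2 * e \<le> t" "e * (\<Sum>b\<in>B. norm (x b)) \<le> t" "e \<le> t"
    using t X by (auto simp: e_def field_simps intro: add_pos_nonneg)
  define \<rho> :: "(('a, 'b) injective_tensor \<Rightarrow>\<^sub>L real) \<Rightarrow> ('a, 'b) tensor \<Rightarrow>\<^sub>L real"
    where "\<rho> \<phi> = \<phi> o\<^sub>L Blinfun to_completion" for \<phi>
  have \<rho>: "blinfun_apply (\<rho> \<phi>) v = \<phi> (to_completion v)" for \<phi> v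
    by (simp add: \<rho>_def bounded_linear_Blinfun_apply[OF bounded_linear_to_completion])
  let ?A = "(\<lambda>(\<phi>, b). partial_functional (\<rho> \<phi>) b) ` (\<Phi> \<times> B)"
  have "\<exists>h\<in>S. \<exists>T :: ('a \<Rightarrow>\<^sub>L real) \<Rightarrow>\<^sub>L ('a \<Rightarrow>\<^sub>L real). norm T \<le> 1 + e \<and>
    (\<forall>v\<in>?A. norm (blinfun_apply T v - v) \<le> e) \<and> norm (blinfun_apply T h - (- f)) < e"
  proof (rule WODP_finite_set[OF assms(3) _ _ S _ e(1)])
    show "\<exists>h :: 'a \<Rightarrow>\<^sub>L real. h \<noteq> 0" using f by (intro exI[of _ f]) auto
  qed (use \<Phi> B f in auto)
  then obtain h and T :: "('a \<Rightarrow>\<^sub>L real) \<Rightarrow>\<^sub>L ('a \<Rightarrow>\<^sub>L real)" where hS: "h \<in> S"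
    and T: "norm T \<le> 1 + e" "\<And>v. v \<in> ?A \<Longrightarrow> norm (T v - v) \<le> e" "norm (T h - (- f)) < e"
    by blast
  have norm_h: "norm h \<le> 1" using hS by (simp add: S_def)
  have h_x0: "1 - 3 * t < h x0"
  proof -
    have "bdd_above ((\<lambda>h. ev h) ` cball 0 1)"
    proof (rule bdd_aboveI2)
      fix h :: "'a \<Rightarrow>\<^sub>L real" assume "h \<in> cball 0 1"
      then show "ev h \<le> norm ev"
        using norm_blinfun[of ev h] mult_left_mono[of "norm h" 1 "norm ev"] by simp
    qed
    then have "ev f \<le> (SUP h\<in>cball 0 1. ev h)" using f by (intro cSUP_upper) auto
    moreover have "ev h > (SUP h\<in>cball 0 1. ev h) - t" using hS by (simp add: S_def)
    ultimately show ?thesis using fg by (simp add: ev eval_x0)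
  qed
  have Th_x0: "T h x0 \<le> 3 * t - 1"
  proof -
    have "\<bar>(T h - (- f)) x0\<bar> \<le> norm (T h - (- f)) * norm x0"
      using norm_blinfun[of "T h - (- f)" x0] by simp
    also have "\<dots> \<le> e * 2" using T(3) norm_x0 e by (intro mult_mono) auto
    finally have "T h x0 + f x0 \<le> t" using e by (simp add: blinfun.diff_left blinfun.add_left blinfun.minus_left)
    then show ?thesis using fg by (simp add: eval_x0)
  qed

  define E :: "('a, 'b) tensor \<Rightarrow>\<^sub>L real" where "E = Blinfun (tensor_eval h g)"
  have E: "blinfun_apply E v = tensor_eval h g v" for v
  proof -
    have "bounded_linear (tensor_eval h g)"
    proof (rule bounded_linear_intro)
      show "norm (tensor_eval h g v) \<le> norm v * (norm h * norm g)" for v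
        using abs_tensor_eval_le[of h g v] by (simp add: mult.commute)
    qed (simp_all add: linear_add[OF linear_tensor_eval] linear_scale[OF linear_tensor_eval])
    then show ?thesis by (simp add: E_def bounded_linear_Blinfun_apply)
  qed
  \<comment> \<open>Two factors \<open>1 + t\<close> bound \<open>norm T\<close> and \<open>norm u\<close>; the third makes the inequality strict.\<close>
  define m where "m = (1 + t) ^ 3"
  have m: "1 \<le> m" "m - 1 \<le> 7 * t"
  proof -
    show "1 \<le> m" using t by (simp add: m_def)
    have "t * t \<le> 1 * t" using t t_le by (intro mult_right_mono) auto
    moreover have "t * (t * t) \<le> 1 * (t * t)" using t t_le by (intro mult_right_mono) auto
    ultimately show "m - 1 \<le> 7 * t" by (simp add: m_def power3_eq_cube algebra_simps)
  qed
  have "norm T * norm u < m"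
  proof -
    have "norm T * norm u \<le> (1 + t) * (1 + t)"
      using T(1) e norm_u t by (intro mult_mono) auto
    also have "\<dots> < (1 + t) * (1 + t) * (1 + t)" using t by simp
    finally show ?thesis by (simp add: m_def power3_eq_cube)
  qed
  then have "\<exists>w. norm w \<le> m \<and> (\<forall>\<psi>\<in>insert E (\<rho> ` \<Phi>). blinfun_apply \<psi> w
    = (\<Sum>b\<in>B. blinfun_apply (blinfun_apply T (partial_functional \<psi> b)) (x b)))"
    unfolding u_eq using \<Phi> by (intro tensor_moved_by_dual_operator[OF B]) auto
  then obtain w where norm_w: "norm w \<le> m"
    and w: "\<And>\<psi>. \<psi> \<in> insert E (\<rho> ` \<Phi>) \<Longrightarrow> blinfun_apply \<psi> w
      = (\<Sum>b\<in>B. blinfun_apply (blinfun_apply T (partial_functional \<psi> b)) (x b))"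
    by blast
  have "tensor_eval h g w = T h x0"
  proof -
    have "partial_functional E b = g b *\<^sub>R h" for b
      by (rule blinfun_eqI) (simp add: E blinfun.scaleR_left)
    then show ?thesis
      using w[of E] by (simp add: E x0_def blinfun.scaleR_right blinfun.scaleR_left blinfun.sum_right)
  qed
  then have far: "2 - 6 * t \<le> norm (u - w)"
  proof -
    have "2 - 6 * t \<le> tensor_eval h g (u - w)"
      using \<open>tensor_eval h g w = T h x0\<close> h_x0 Th_x0
      by (simp add: linear_diff[OF linear_tensor_eval] eval_x0)
    also have "\<dots> \<le> norm h * norm (u - w)" using abs_tensor_eval_le[of h g "u - w"] g by simp
    also have "\<dots> \<le> norm (u - w)" using norm_h by (simp add: mult_left_le_one_le)
    finally show ?thesis .
  qed
  have near: "\<bar>\<rho> \<phi> w - \<rho> \<phi> u\<bar> \<le> t" if \<phi>: "\<phi> \<in> \<Phi>" for \<phi>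
  proof -
    let ?p = "partial_functional (\<rho> \<phi>)"
    have "\<rho> \<phi> w - \<rho> \<phi> u = (\<Sum>b\<in>B. (T (?p b) - ?p b) (x b))"
      using w[of "\<rho> \<phi>"] \<phi> by (simp add: u_eq blinfun.sum_right blinfun.diff_left sum_subtractf)
    also have "\<bar>\<dots>\<bar> \<le> (\<Sum>b\<in>B. e * norm (x b))"
    proof (rule order_trans[OF sum_abs], rule sum_mono)
      fix b assume "b \<in> B"
      then have "norm (T (?p b) - ?p b) \<le> e" using \<phi> by (intro T(2)) auto
      then show "\<bar>(T (?p b) - ?p b) (x b)\<bar> \<le> e * norm (x b)"
        using norm_blinfun[of "T (?p b) - ?p b" "x b"]
          mult_right_mono[of "norm (T (?p b) - ?p b)" e "norm (x b)"] by simp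
    qed
    also have "\<dots> \<le> t" using e(3) by (simp add: sum_distrib_left)
    finally show ?thesis .
  qed

  \<comment> \<open>The norm of \<open>w\<close> may exceed \<open>1\<close>; scaling back into the unit ball moves \<open>w\<close> by at most \<open>7 t\<close>.\<close>
  define w' where "w' = w /\<^sub>R m"
  have norm_w': "norm w' \<le> 1" using norm_w m(1) by (simp add: w'_def field_simps)
  have ww': "norm (w - w') \<le> 7 * t"
  proof -
    have "w - w' = (m - 1) *\<^sub>R w'" using m(1) by (simp add: w'_def algebra_simps)
    then have "norm (w - w') = (m - 1) * norm w'" using m(1) by simp
    also have "\<dots> \<le> (m - 1) * 1" using m(1) norm_w' by (intro mult_left_mono) auto
    finally show ?thesis using m(2) by simp
  qed
  note to_completion_diff = linear_diff[OF bounded_linear.linear[OF bounded_linear_to_completion], symmetric]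
  have "to_completion w' \<in> U"
  proof -
    have "\<bar>\<phi> (to_completion w') - \<phi> z\<bar> < \<delta>" if \<phi>: "\<phi> \<in> \<Phi>" for \<phi>
    proof -
      have "\<bar>\<phi> v\<bar> \<le> K * norm v" for v
        using norm_blinfun[of \<phi> v] mult_right_mono[OF norm_\<phi>[OF \<phi>], of "norm v"] by simp
      note le = this
      have "\<bar>\<phi> (to_completion w - to_completion w')\<bar> \<le> K * (7 * t)"
        using le[of "to_completion w - to_completion w'"] mult_left_mono[OF ww' K]
        by (simp add: to_completion_diff)
      moreover have "\<bar>\<phi> (to_completion u - z)\<bar> \<le> K * t"
        using le[of "to_completion u - z"] mult_left_mono[OF less_imp_le[OF u] K] by simp
      ultimately have "\<bar>\<phi> (to_completion w') - \<phi> z\<bar> \<le> K * (7 * t) + t + K * t"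
        using near[OF \<phi>] by (simp add: \<rho> blinfun.diff_right)
      also have "\<dots> < (8 * K + 2) * t" using t by (simp add: algebra_simps)
      finally show ?thesis using t\<delta> by simp
    qed
    then show ?thesis using \<Phi> by blast
  qed
  then have "to_completion w' \<in> W" using norm_w' U(2) by simp
  moreover have "norm (to_completion w' - z) > 2 - \<epsilon>"
  proof -
    have "norm (u - w) \<le> norm (u - w') + norm (w' - w)"
      using norm_triangle_ineq[of "u - w'" "w' - w"] by simp
    moreover have "norm (u - w') \<le> norm (to_completion u - z) + norm (z - to_completion w')"
      using norm_triangle_ineq[of "to_completion u - z" "z - to_completion w'"]
      by (simp add: to_completion_diff)
    ultimately show ?thesis
      using far ww' u t t_le by (simp add: norm_minus_commute)
  qed
  ultimately show "\<exists>w\<in>W. norm (w - z) > 2 - \<epsilon>" by blast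
qed

end
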